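(* For each integer $\kappa\ge0$, $J\ge0$ and $\ell\ge1$, provided $u\ge\ell$, \begin{multline*} K_{\ell}(u,\kappa)=\sum_{m=0}^{\ell}\sum_{n=m}^{\kappa}\sum_{r=0}^{\ell-m}\frac{(-1)^{r}\kappa!\,E_{n,m}}{m!\,(\ell-m-r)!}C_{r,\kappa-n}u^{\kappa-n}\log^{\ell-m-r}u\\ +\sum_{j=1}^{J}\sum_{m=0}^{\ell}\sum_{r=0}^{\ell-m}\frac{(-1)^{r}\kappa!\,E_{\kappa+j,m}}{m!\,(\ell-m-r)!}C_{r}\left(\log^{\ell-m-r}u\right)^{(j)}+O_{\kappa,\ell,J}\!\left(\frac{\log^{\ell}(eu)}{u^{J+1}}\right), \end{multline*} where the implied constant depends only on $\kappa,\ell,J$ (and the sum over $n$ is empty when $m>\kappa$).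
   Context: For integers $\ell\ge1$, $\kappa\ge0$ and real $u>0$, \[ K_{\ell}(u,\kappa):=\frac{1}{\ell!}\int\cdots\int_{\substack{t_{1},\ldots,t_{\ell}\ge1\\ t_{1}+\cdots+t_{\ell}\le u}}\left(u-(t_1+\cdots+t_\ell)\right)^{\kappa}\frac{dt_{1}}{t_{1}}\cdots\frac{dt_{\ell}}{t_{\ell}}. \] The constants $C_{r,\kappa}$ ($r,\kappa\ge0$) are defined by $\sum_{r\ge0}C_{r,\kappa}z^r=e^{\gamma z}/\Gamma(\kappa+1-z)$, $\gamma$ Euler's constant, and $C_r:=C_{r,0}$. The constants $E_{j,m}$ ($j,m\ge0$) are defined by $\sum_{j\ge0}E_{j,m}z^j=\left(\int_0^z\frac{1-e^{-t}}{t}\,dt\right)^m$. The notation $\left(\log^{k}u\right)^{(j)}$ denotes the $j$-th derivative with respect to $u$ of $(\log u)^k$. *)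

theory Defs
  imports "HOL-Analysis.Analysis"
begin

definition K_fun :: "nat \<Rightarrow> real \<Rightarrow> nat \<Rightarrow> real" where
  "K_fun l u \<kappa> = (1 / fact l) *
     (\<integral>t. indicator {t. (\<forall>i<l. 1 \<le> t i) \<and> (\<Sum>i<l. t i) \<le> u} t
           * (u - (\<Sum>i<l. t i)) ^ \<kappa> / (\<Prod>i<l. t i)
        \<partial>(PiM {..<l} (\<lambda>_. lborel)))"

definition C_coef :: "nat \<Rightarrow> nat \<Rightarrow> real" where
  "C_coef r \<kappa> = (deriv ^^ r) (\<lambda>z::real. exp (euler_mascheroni * z) * rGamma (real \<kappa> + 1 - z)) 0
                   / fact r"

definition Ein :: "real \<Rightarrow> real" where
  "Ein z = (LBINT t=0..z. (1 - exp (- t)) / t)"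

definition E_coef :: "nat \<Rightarrow> nat \<Rightarrow> real" where
  "E_coef j m = (deriv ^^ j) (\<lambda>z. Ein z ^ m) 0 / fact j"

end

theory Submission
  imports Defs
begin

text \<open>
  Write \<open>K\<^sub>l(u, \<kappa>)\<close> for \<open>K_fun l u \<kappa>\<close>. Splitting \<open>u = (u - \<Sum>t\<^sub>i) + \<Sum>t\<^sub>i\<close> in the integrand and using symmetry gives
  \<open>u K\<^sub>l(u, \<kappa>) = K\<^sub>l(u, \<kappa>+1) + K\<^sub>l\<^sub>-\<^sub>1(u-1, \<kappa>+1) / (\<kappa>+1)\<close>; for \<open>\<kappa> = -1\<close> this reads
  \<open>u K\<^sub>l'(u, 0) = K\<^sub>l\<^sub>-\<^sub>1(u-1, 0)\<close>.
  The claimed expansion is the formal inverse Laplace transform of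
  \<open>\<kappa>! s^(-\<kappa>-1) (Ein(s) - \<gamma> - ln s)^l / l!\<close>, and it satisfies the same recursion with the shift by \<open>-1\<close>
  replaced by its Taylor series. For \<open>\<kappa> = 0\<close> induction on \<open>l\<close> therefore gives the expansion of the derivative,
  hence that of \<open>K\<^sub>l(u, 0)\<close> up to an additive constant. The constant vanishes because the Laplace transforms
  \<open>E\<^sub>1(s)^l / l!\<close> and \<open>(-\<gamma> - ln s)^l / l!\<close> of \<open>dK\<^sub>l(u, 0)\<close> and of the leading term differ by \<open>o(1)\<close> as
  \<open>s \<rightarrow> 0\<close>. Larger \<open>\<kappa>\<close> follow algebraically from the recursion.
\<close>

section \<open>Iterated integrals\<close>

text \<open>The transform comes from E_1(s), the integral of exp(-s t)/t over t \<ge> 1, which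
  equals Ein(s) - \<gamma> - ln s. Expanding its l-th power in powers of Ein produces the numbers
  E_{n,m}. What is left, s^(n-\<kappa>-1) (-\<gamma> - ln s)^k / k!, is the transform of the
  coefficient of z^k in exp(-\<gamma> z) u^(\<kappa>-n+z) / \<Gamma>(\<kappa>-n+1+z), which produces
  the C_{r,\<kappa>-n}. For n > \<kappa> these functions are derivatives of those with n = \<kappa>,
  hence the second sum. Inverting the transform would require control at complex s; the recursion
  uses only real variables. Its weak point is \<kappa> = -1: the coefficient \<kappa>+1 vanishes,
  only a derivative is determined, and the lost constant is invisible to any recursion near
  infinity. Since integrating the derivative already shows that the difference converges, an Abelian
  statement at s = 0 suffices to find the constant; no Tauberian argument occurs. The truncation
  order N stays fixed when \<kappa> grows: the factor u in the recursion raises the error exponent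
  \<kappa>-N-1 by exactly one.\<close>

text \<open>\<open>simplex_int l \<kappa> u = l! K\<^sub>l(u, \<kappa>)\<close>, as an iterated convolution; values in \<^typ>\<open>ennreal\<close> make Tonelli applicable without integrability side conditions.\<close>

primrec simplex_int :: "nat \<Rightarrow> nat \<Rightarrow> real \<Rightarrow> ennreal" where
  "simplex_int 0 \<kappa> = (\<lambda>u. ennreal (indicator {0..} u * u ^ \<kappa>))"
| "simplex_int (Suc l) \<kappa> = (\<lambda>u. \<integral>\<^sup>+t. ennreal (indicator {1..} t / t) * simplex_int l \<kappa> (u - t) \<partial>lborel)"

text \<open>In the recursion a factor t cancels the weight 1/t, and this unweighted integral of the
  previous level remains.\<close>

definition simplex_prim :: "nat \<Rightarrow> nat \<Rightarrow> real \<Rightarrow> ennreal" where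
  "simplex_prim l \<kappa> u = (\<integral>\<^sup>+v. indicator {..u} v * simplex_int l \<kappa> v \<partial>lborel)"

lemma simplex_int_measurable [measurable]: "simplex_int l \<kappa> \<in> borel_measurable borel"
  by (induction l) simp_all

lemma simplex_int_neg: "u < 0 \<Longrightarrow> simplex_int l \<kappa> u = 0"
proof (induction l arbitrary: u)
  case (Suc l)
  have "ennreal (indicator {1..} t / t) * simplex_int l \<kappa> (u - t) = 0" for t
    using Suc by (auto simp: indicator_def)
  then show ?case by (simp del: mult_eq_0_iff)
qed simp

lemma simplex_prim_measurable [measurable]: "simplex_prim l \<kappa> \<in> borel_measurable borel"
  unfolding simplex_prim_def[abs_def] indicator_def atMost_iff by measurable

lemma simplex_prim_Suc: "simplex_prim (Suc l) \<kappa> u = (\<integral>\<^sup>+t. ennreal (indicator {1..} t / t) * simplex_prim l \<kappa> (u - t) \<partial>lborel)"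
proof -
  have "simplex_prim (Suc l) \<kappa> u =
     (\<integral>\<^sup>+v. \<integral>\<^sup>+t. indicator {..u} v * (ennreal (indicator {1..} t / t) * simplex_int l \<kappa> (v - t)) \<partial>lborel \<partial>lborel)"
    unfolding simplex_prim_def by (simp add: nn_integral_cmult)
  also have "\<dots> =
     (\<integral>\<^sup>+t. \<integral>\<^sup>+v. indicator {..u} v * (ennreal (indicator {1..} t / t) * simplex_int l \<kappa> (v - t)) \<partial>lborel \<partial>lborel)"
    by (rule lborel_pair.Fubini') measurable
  also have "\<dots> =
     (\<integral>\<^sup>+t. ennreal (indicator {1..} t / t) * (\<integral>\<^sup>+v. indicator {..u} v * simplex_int l \<kappa> (v - t) \<partial>lborel) \<partial>lborel)"
    by (simp add: nn_integral_cmult[symmetric] mult_ac)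
  also have "\<dots> = (\<integral>\<^sup>+t. ennreal (indicator {1..} t / t) * simplex_prim l \<kappa> (u - t) \<partial>lborel)"
  proof -
    have "(\<integral>\<^sup>+v. indicator {..u} v * simplex_int l \<kappa> (v - t) \<partial>lborel) = simplex_prim l \<kappa> (u - t)" for t
      unfolding simplex_prim_def
      by (subst nn_integral_real_affine[of _ 1 t])
         (auto intro!: nn_integral_cong simp: indicator_def)
    then show ?thesis by simp
  qed
  finally show ?thesis .
qed

lemma simplex_prim_0: "ennreal (real (Suc \<kappa>)) * simplex_prim 0 \<kappa> u = simplex_int 0 (Suc \<kappa>) u"
proof (cases "u \<ge> 0")
  case True
  have "simplex_prim 0 \<kappa> u = (\<integral>\<^sup>+v. ennreal (v ^ \<kappa>) * indicator {0..u} v \<partial>lborel)"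
    unfolding simplex_prim_def by (auto intro!: nn_integral_cong simp: indicator_def)
  also have "\<dots> = ennreal (u ^ Suc \<kappa> / real (Suc \<kappa>) - 0 ^ Suc \<kappa> / real (Suc \<kappa>))"
  proof (rule nn_integral_FTC_Icc)
    fix x :: real
    show "((\<lambda>x. x ^ Suc \<kappa> / real (Suc \<kappa>)) has_real_derivative x ^ \<kappa>) (at x)"
      by (rule derivative_eq_intros refl | simp)+
  qed (use True in auto)
  finally show ?thesis using True
    by (simp add: ennreal_mult[symmetric] del: of_nat_Suc)
next
  case False
  have "indicator {..u} v * simplex_int 0 \<kappa> v = 0" for v
    using False by (auto simp: indicator_def)
  then have "simplex_prim 0 \<kappa> u = 0" unfolding simplex_prim_def by (simp del: mult_eq_0_iff simplex_int.simps)
  then show ?thesis using False by (simp add: indicator_def)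
qed

text \<open>Integration up to u commutes with convolution by 1/t, so the power rule at level 0
  propagates to every l.\<close>

lemma simplex_prim_eq: "ennreal (real (Suc \<kappa>)) * simplex_prim l \<kappa> u = simplex_int l (Suc \<kappa>) u"
proof (induction l arbitrary: u)
  case 0
  show ?case by (rule simplex_prim_0)
next
  case (Suc l)
  have "ennreal (real (Suc \<kappa>)) * simplex_prim (Suc l) \<kappa> u =
     (\<integral>\<^sup>+t. ennreal (indicator {1..} t / t) * (ennreal (real (Suc \<kappa>)) * simplex_prim l \<kappa> (u - t)) \<partial>lborel)"
    unfolding simplex_prim_Suc by (subst nn_integral_cmult[symmetric]) (simp_all add: mult_ac)
  then show ?case unfolding Suc by simp
qed

text \<open>Split u = (u - t) + t in the outermost variable. The summand t cancels the weight and
  leaves a primitive; the summand u - t is handled by the induction hypothesis at u - t. Each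
  variable contributes one primitive, hence the factor l, which also neutralises
  \<open>l - 1\<close> at l = 0.\<close>

lemma simplex_int_recursion: "ennreal u * simplex_int l \<kappa> u = simplex_int l (Suc \<kappa>) u + of_nat l * simplex_prim (l - 1) \<kappa> (u - 1)"
proof (induction l arbitrary: u)
  case 0
  show ?case by (cases "u \<ge> 0") (auto simp: ennreal_mult[symmetric] indicator_def)
next
  case (Suc l)
  let ?g = "\<lambda>t::real. ennreal (indicator {1..} t / t)"
  \<comment> \<open>Outside 1 \<le> t \<le> u both sides vanish, so the truncation of
    \<open>ennreal (u - t)\<close> at 0 does no harm.\<close>
  have split: "ennreal u * (?g t * simplex_int l \<kappa> (u - t)) =
     ?g t * (ennreal (u - t) * simplex_int l \<kappa> (u - t)) + indicator {1..} t * simplex_int l \<kappa> (u - t)" for t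
  proof (cases "1 \<le> t \<and> t \<le> u")
    case True
    have "ennreal u * ?g t = ?g t * ennreal (u - t) + indicator {1..} t"
    proof -
      have "ennreal u * ennreal (1 / t) = ennreal (1 / t * (u - t) + 1)"
        using True by (subst ennreal_mult'[symmetric]) (auto simp: field_simps)
      also have "\<dots> = ennreal (1 / t) * ennreal (u - t) + 1"
        using True by (subst ennreal_plus) (auto simp: ennreal_mult'[symmetric] simp del: ennreal_plus)
      finally show ?thesis using True by simp
    qed
    then show ?thesis by (metis (no_types, lifting) distrib_right mult.assoc)
  next
    case False
    then show ?thesis by (auto simp: indicator_def simplex_int_neg)
  qed
  have "ennreal u * simplex_int (Suc l) \<kappa> u = (\<integral>\<^sup>+t. ennreal u * (?g t * simplex_int l \<kappa> (u - t)) \<partial>lborel)"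
    by (simp add: nn_integral_cmult)
  also have "\<dots> = (\<integral>\<^sup>+t. ?g t * (ennreal (u - t) * simplex_int l \<kappa> (u - t)) \<partial>lborel)
               + (\<integral>\<^sup>+t. indicator {1..} t * simplex_int l \<kappa> (u - t) \<partial>lborel)"
    unfolding split by (rule nn_integral_add) measurable
  also have "(\<integral>\<^sup>+t. indicator {1..} t * simplex_int l \<kappa> (u - t) \<partial>lborel) = simplex_prim l \<kappa> (u - 1)"
    unfolding simplex_prim_def
    by (subst nn_integral_real_affine[of _ "-1" u])
       (auto intro!: nn_integral_cong simp: indicator_def)
  also have "(\<integral>\<^sup>+t. ?g t * (ennreal (u - t) * simplex_int l \<kappa> (u - t)) \<partial>lborel)
     = (\<integral>\<^sup>+t. ?g t * simplex_int l (Suc \<kappa>) (u - t) \<partial>lborel)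
       + of_nat l * (\<integral>\<^sup>+t. ?g t * simplex_prim (l - 1) \<kappa> (u - 1 - t) \<partial>lborel)"
  proof -
    have shift: "u - t - 1 = u - 1 - t" for t by simp
    show ?thesis unfolding Suc shift
      by (subst nn_integral_cmult[symmetric], measurable, subst nn_integral_add[symmetric])
         (auto intro!: nn_integral_cong simp: distrib_left mult_ac)
  qed
  also have "of_nat l * (\<integral>\<^sup>+t. ?g t * simplex_prim (l - 1) \<kappa> (u - 1 - t) \<partial>lborel) = of_nat l * simplex_prim l \<kappa> (u - 1)"
    by (cases l) (simp_all add: simplex_prim_Suc)
  finally show ?case by (simp add: algebra_simps)
qed

text \<open>Crude: every weight is at most 1 and every variable runs over an interval of length at
  most u. This yields finiteness and, at the very end, boundedness of K on compact ranges.\<close>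

lemma simplex_int_bound: "simplex_int l \<kappa> u \<le> ennreal (max 0 u ^ (\<kappa> + l))"
proof (induction l arbitrary: u)
  case 0
  show ?case by (auto simp: indicator_def intro!: ennreal_leI power_mono)
next
  case (Suc l)
  show ?case
  proof (cases "u \<ge> 0")
    case True
    have "simplex_int (Suc l) \<kappa> u \<le> (\<integral>\<^sup>+t. ennreal (u ^ (\<kappa> + l)) * indicator {0..u} t \<partial>lborel)"
      unfolding simplex_int.simps
    proof (rule nn_integral_mono)
      fix t :: real
      show "ennreal (indicator {1..} t / t) * simplex_int l \<kappa> (u - t) \<le> ennreal (u ^ (\<kappa> + l)) * indicator {0..u} t"
      proof (cases "1 \<le> t \<and> t \<le> u")
        case True
        then have "ennreal (indicator {1..} t / t) * simplex_int l \<kappa> (u - t) \<le> 1 * ennreal (max 0 (u - t) ^ (\<kappa> + l))"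
          by (intro mult_mono Suc) auto
        also have "\<dots> \<le> ennreal (u ^ (\<kappa> + l))"
          using True by (auto intro!: ennreal_leI power_mono)
        finally show ?thesis using True by simp
      qed (auto simp: indicator_def simplex_int_neg)
    qed
    also have "\<dots> = ennreal (u ^ (\<kappa> + l)) * ennreal u"
      using True by (subst nn_integral_cmult) auto
    finally show ?thesis using True by (simp add: ennreal_mult[symmetric] mult_ac)
  qed (simp add: simplex_int_neg del: simplex_int.simps)
qed

text \<open>The exponential integral E_1(s).\<close>

definition exp_int :: "real \<Rightarrow> ennreal" where
  "exp_int s = (\<integral>\<^sup>+t. ennreal (indicator {1..} t / t * exp (- s * t)) \<partial>lborel)"

text \<open>Tonelli and translation invariance turn each convolution into a factor E_1(s).\<close>

lemma simplex_int_laplace: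
  "(\<integral>\<^sup>+u. ennreal (exp (- s * u)) * simplex_int l \<kappa> u \<partial>lborel)
     = exp_int s ^ l * (\<integral>\<^sup>+u. ennreal (exp (- s * u)) * simplex_int 0 \<kappa> u \<partial>lborel)"
proof (induction l)
  case (Suc l)
  let ?g = "\<lambda>t::real. ennreal (indicator {1..} t / t)"
  have "(\<integral>\<^sup>+u. ennreal (exp (- s * u)) * simplex_int (Suc l) \<kappa> u \<partial>lborel) =
     (\<integral>\<^sup>+u. \<integral>\<^sup>+t. ennreal (exp (- s * u)) * (?g t * simplex_int l \<kappa> (u - t)) \<partial>lborel \<partial>lborel)"
    by (simp add: nn_integral_cmult)
  also have "\<dots> = (\<integral>\<^sup>+t. \<integral>\<^sup>+u. ennreal (exp (- s * u)) * (?g t * simplex_int l \<kappa> (u - t)) \<partial>lborel \<partial>lborel)"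
    by (rule lborel_pair.Fubini') measurable
  also have "\<dots> = (\<integral>\<^sup>+t. ennreal (indicator {1..} t / t * exp (- s * t)) *
        (\<integral>\<^sup>+u. ennreal (exp (- s * u)) * simplex_int l \<kappa> u \<partial>lborel) \<partial>lborel)"
  proof (rule nn_integral_cong)
    fix t :: real
    have "(\<integral>\<^sup>+u. ennreal (exp (- s * u)) * (?g t * simplex_int l \<kappa> (u - t)) \<partial>lborel)
       = (\<integral>\<^sup>+u. ennreal (exp (- s * (t + u))) * (?g t * simplex_int l \<kappa> u) \<partial>lborel)"
      by (subst nn_integral_real_affine[of _ 1 t]) auto
    also have "\<dots> = (\<integral>\<^sup>+u. ennreal (indicator {1..} t / t * exp (- s * t)) *
        (ennreal (exp (- s * u)) * simplex_int l \<kappa> u) \<partial>lborel)"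
    proof (rule nn_integral_cong)
      fix u
      have "exp (- s * (t + u)) * (indicator {1..} t / t) = indicator {1..} t / t * exp (- s * t) * exp (- s * u)"
        by (simp add: exp_add[symmetric] ring_distribs)
      then have "ennreal (exp (- s * (t + u))) * ?g t
          = ennreal (indicator {1..} t / t * exp (- s * t)) * ennreal (exp (- s * u))"
        by (simp add: ennreal_mult''[symmetric] indicator_def)
      then show "ennreal (exp (- s * (t + u))) * (?g t * simplex_int l \<kappa> u) =
        ennreal (indicator {1..} t / t * exp (- s * t)) * (ennreal (exp (- s * u)) * simplex_int l \<kappa> u)"
        by (metis mult.assoc)
    qed
    finally show "(\<integral>\<^sup>+u. ennreal (exp (- s * u)) * (?g t * simplex_int l \<kappa> (u - t)) \<partial>lborel) =
      ennreal (indicator {1..} t / t * exp (- s * t)) *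
        (\<integral>\<^sup>+u. ennreal (exp (- s * u)) * simplex_int l \<kappa> u \<partial>lborel)"
      by (simp add: nn_integral_cmult)
  qed
  also have "\<dots> = exp_int s * (\<integral>\<^sup>+u. ennreal (exp (- s * u)) * simplex_int l \<kappa> u \<partial>lborel)"
    unfolding exp_int_def by (simp add: nn_integral_multc)
  finally show ?case unfolding Suc by (simp add: mult_ac)
qed simp

section \<open>Identification with the integral over the product measure\<close>

interpretation lborel_prod: product_sigma_finite "\<lambda>_::nat. lborel :: real measure"
  by unfold_locales

lemma simplex_integrand_measurable:
  fixes l :: nat
  shows "(\<lambda>t. indicator {t. (\<forall>i<l. 1 \<le> t i) \<and> (\<Sum>i<l. t i) \<le> u} t
       * (u - (\<Sum>i<l. t i)) ^ \<kappa> / (\<Prod>i<l. t i)) \<in> borel_measurable (PiM {..<l} (\<lambda>_. lborel :: real measure))"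
proof -
  have comp: "(\<lambda>t. t i) \<in> borel_measurable (PiM {..<l} (\<lambda>_. lborel :: real measure))" if "i < l" for i
    using measurable_component_singleton[of i "{..<l}" "\<lambda>_. lborel :: real measure"] that by simp
  have [measurable]: "(\<lambda>t. \<Sum>i<l. t i) \<in> borel_measurable (PiM {..<l} (\<lambda>_. lborel :: real measure))"
    by (intro borel_measurable_sum comp) simp
  have [measurable]: "(\<lambda>t. \<Prod>i<l. t i) \<in> borel_measurable (PiM {..<l} (\<lambda>_. lborel :: real measure))"
    by (intro borel_measurable_prod comp) simp
  have "Measurable.pred (PiM {..<l} (\<lambda>_. lborel :: real measure)) (\<lambda>t. \<forall>i\<in>{..<l}. 1 \<le> t i)"
    by (rule pred_intros_finite(3)) (use comp in \<open>auto intro!: borel_measurable_le simp: pred_def\<close>)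
  then have [measurable]: "Measurable.pred (PiM {..<l} (\<lambda>_. lborel :: real measure)) (\<lambda>t. \<forall>i<l. 1 \<le> t i)"
    by (simp add: Ball_def)
  show ?thesis unfolding indicator_def by measurable
qed

text \<open>Peel off the last coordinate y: the constraints separate into 1 \<le> y and the same
  constraints in one dimension less with u replaced by u - y.\<close>

lemma simplex_nn_integral:
  "(\<integral>\<^sup>+t. ennreal (indicator {t. (\<forall>i<l. 1 \<le> t i) \<and> (\<Sum>i<l. t i) \<le> u} t
           * (u - (\<Sum>i<l. t i)) ^ \<kappa> / (\<Prod>i<l. t i)) \<partial>(PiM {..<l} (\<lambda>_. lborel))) = simplex_int l \<kappa> u"
proof (induction l arbitrary: u)
  case 0
  show ?case by (simp add: PiM_empty nn_integral_count_space_finite indicator_def)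
next
  case (Suc l)
  let ?f = "\<lambda>l u t. ennreal (indicator {t. (\<forall>i<l. 1 \<le> t i) \<and> (\<Sum>i<l. t i) \<le> u} t
           * (u - (\<Sum>i<l. t i)) ^ \<kappa> / (\<Prod>i<l. t i))"
  note meas = simplex_integrand_measurable[THEN measurable_compose, OF measurable_ennreal]
  note [measurable] = meas
  have upd: "?f (Suc l) u (x(l := y)) = ennreal (indicator {1..} y / y) * ?f l (u - y) x" for x y
  proof (cases "(\<forall>i<l. 1 \<le> x i) \<and> (\<Sum>i<l. x i) \<le> u - y")
    case True
    then have "(\<Prod>i<l. x i) \<ge> 0" by (intro prod_nonneg) (force intro: order_trans[of 0 1])
    then show ?thesis using True
      by (auto simp: ennreal_mult[symmetric] indicator_def less_Suc_eq algebra_simps)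
  next
    case False
    then show ?thesis by (auto simp: indicator_def less_Suc_eq algebra_simps)
  qed
  have "(\<integral>\<^sup>+t. ?f (Suc l) u t \<partial>(PiM {..<Suc l} (\<lambda>_. lborel)))
      = (\<integral>\<^sup>+y. \<integral>\<^sup>+x. ?f (Suc l) u (x(l := y)) \<partial>(PiM {..<l} (\<lambda>_. lborel)) \<partial>lborel)"
    using lborel_prod.product_nn_integral_insert_rev[of "{..<l}" l "?f (Suc l) u"] meas[of "Suc l"]
    by (simp only: lessThan_Suc[symmetric]) auto
  also have "\<dots> = simplex_int (Suc l) \<kappa> u"
    unfolding upd by (subst nn_integral_cmult) (auto simp: Suc)
  finally show ?case .
qed

text \<open>Measurability and nonnegativity of the integrand are enough here; that the value is a
  genuine finite integral follows from \<open>simplex_int_bound\<close>.\<close>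

lemma K_fun_eq: "K_fun l u \<kappa> = enn2real (simplex_int l \<kappa> u) / fact l"
proof -
  let ?f = "\<lambda>t. indicator {t. (\<forall>i<l. 1 \<le> t i) \<and> (\<Sum>i<l. t i) \<le> u} t
           * (u - (\<Sum>i<l. t i)) ^ \<kappa> / (\<Prod>i<l. t i)"
  have nonneg: "0 \<le> ?f t" for t
  proof (cases "(\<forall>i<l. 1 \<le> t i) \<and> (\<Sum>i<l. t i) \<le> u")
    case True
    then have "(\<Prod>i<l. t i) \<ge> 0" by (intro prod_nonneg) (force intro: order_trans[of 0 1])
    with True show ?thesis by (simp add: indicator_def)
  qed (auto simp: indicator_def)
  have "integral\<^sup>L (PiM {..<l} (\<lambda>_. lborel)) ?f = enn2real (simplex_int l \<kappa> u)"
    unfolding simplex_nn_integral[symmetric]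
    by (rule integral_eq_nn_integral) (use nonneg in \<open>auto intro: simplex_integrand_measurable\<close>)
  then show ?thesis unfolding K_fun_def by simp
qed

section \<open>Generating functions of the coefficients\<close>

lemma has_fps_expansion_at_0:
  assumes "f has_fps_expansion F"
  shows "f 0 = fps_nth F 0"
proof -
  have "eventually (\<lambda>z. eval_fps F z = f z) (nhds 0)"
    using assms by (simp add: has_fps_expansion_def)
  from eventually_nhds_x_imp_x[OF this] show ?thesis by (simp add: eval_fps_at_0)
qed

text \<open>The bridge from the coefficients defined by iterated \<open>deriv\<close> to formal
  power series, where all identities between them are proved.\<close>

lemma fps_nth_real_expansion:
  fixes f :: "real \<Rightarrow> real"
  assumes "f has_fps_expansion F"
  shows "(deriv ^^ n) f 0 / fact n = fps_nth F n"
proof -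
  have "(deriv ^^ n) f has_fps_expansion fps_nth_deriv n F"
    using assms
  proof (induction n arbitrary: f F)
    case (Suc n)
    then show ?case
      using Suc.IH[OF has_fps_expansion_deriv[OF Suc.prems]] by (simp add: funpow_Suc_right del: funpow.simps)
  qed simp
  from has_fps_expansion_at_0[OF this] show ?thesis
    by (simp add: fps_deriv_maclauren_0)
qed

lemma has_fps_expansion_pow:
  fixes f :: "real \<Rightarrow> real"
  shows "f has_fps_expansion F \<Longrightarrow> (\<lambda>x. f x ^ m) has_fps_expansion F ^ m"
proof (induction m)
  case (Suc m)
  then show ?case unfolding power_Suc by (intro has_fps_expansion_mult)
qed simp

text \<open>Termwise integral of (1 - exp(-t))/t. At n = 0 division by zero gives 0, which is the
  correct constant term.\<close>

definition Ein_fps :: "real fps" where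
  "Ein_fps = Abs_fps (\<lambda>n. (-1) ^ (n + 1) / (real n * fact n))"

lemma Ein_fps_0: "fps_nth Ein_fps 0 = 0"
  by (simp add: Ein_fps_def)

text \<open>The differential equation z Ein'(z) = 1 - exp(-z), kept in multiplied form; it drives
  both the evaluation of Ein and the recursion for its powers.\<close>

lemma fps_X_deriv_Ein_fps: "fps_X * fps_deriv Ein_fps = 1 - fps_exp (-1)"
proof (rule fps_ext)
  fix n
  show "fps_nth (fps_X * fps_deriv Ein_fps) n = fps_nth (1 - fps_exp (-1)) n"
  proof (cases n)
    case (Suc k)
    have "fps_nth (fps_X * fps_deriv Ein_fps) n = real (Suc k) * ((-1) ^ k / (real (Suc k) * fact (Suc k)))"
      unfolding Suc Ein_fps_def by (simp del: of_nat_Suc fact_Suc)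
    also have "\<dots> = (-1) ^ k / fact (Suc k)"
      by (simp del: of_nat_Suc fact_Suc)
    finally show ?thesis unfolding Suc by (simp del: of_nat_Suc fact_Suc)
  qed simp
qed

lemma Ein_fps_conv_radius: "fps_conv_radius Ein_fps = \<infinity>"
  unfolding fps_conv_radius_def
proof (rule conv_radius_inftyI'')
  fix z :: real
  have "summable (\<lambda>n. \<bar>z\<bar> ^ n / fact n)"
    using summable_exp[of "\<bar>z\<bar>"] by (simp add: field_simps)
  then show "summable (\<lambda>n. fps_nth Ein_fps n * z ^ n)"
  proof (rule summable_comparison_test'[where N = 1])
    fix n :: nat assume "n \<ge> 1"
    then show "norm (fps_nth Ein_fps n * z ^ n) \<le> \<bar>z\<bar> ^ n / fact n"
      by (auto simp: Ein_fps_def abs_mult power_abs intro!: frac_le mult_left_mono)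
  qed
qed

lemma Ein_eq_eval_fps: "Ein z = eval_fps Ein_fps z"
proof -
  let ?G = "fps_deriv Ein_fps"
  have rad: "fps_conv_radius ?G = \<infinity>"
    using fps_conv_radius_deriv[of Ein_fps] by (simp add: Ein_fps_conv_radius)
  have G: "t * eval_fps ?G t = 1 - exp (- t)" for t :: real
  proof -
    have "t * eval_fps ?G t = eval_fps (fps_X * ?G) t"
      by (subst eval_fps_mult) (auto simp: rad)
    also have "\<dots> = 1 - exp (- t)"
      unfolding fps_X_deriv_Ein_fps by (subst eval_fps_diff) auto
    finally show ?thesis .
  qed
  have deriv: "(eval_fps Ein_fps has_real_derivative eval_fps ?G x) (at x within A)" for x A
    by (rule has_field_derivative_eval_fps) (simp add: Ein_fps_conv_radius)
  \<comment> \<open>At t = 0 the quotient is 0 by convention while the series has value 1; the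
    interval integral only compares the open interval, which excludes that endpoint.\<close>
  have "Ein z = (LBINT t=ereal 0..ereal z. eval_fps ?G t)"
    unfolding Ein_def zero_ereal_def
    by (rule interval_integral_cong) (use G in \<open>auto simp: einterval_iff min_def max_def field_simps split: if_splits\<close>)
  also have "\<dots> = eval_fps Ein_fps z - eval_fps Ein_fps 0"
    by (rule interval_integral_FTC_finite)
       (auto intro!: DERIV_continuous_on[OF has_field_derivative_eval_fps] simp: rad deriv has_real_derivative_iff_has_vector_derivative[symmetric])
  finally show ?thesis by (simp add: eval_fps_at_0 Ein_fps_0)
qed

lemma Ein_has_fps_expansion: "Ein has_fps_expansion Ein_fps"
proof -
  have "Ein = eval_fps Ein_fps" by (simp add: fun_eq_iff Ein_eq_eval_fps)
  moreover have "eval_fps Ein_fps has_fps_expansion Ein_fps"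
    by (rule eval_fps_has_fps_expansion) (simp add: Ein_fps_conv_radius)
  ultimately show ?thesis by metis
qed

lemma E_coef_eq: "E_coef n m = fps_nth (Ein_fps ^ m) n"
  unfolding E_coef_def by (intro fps_nth_real_expansion has_fps_expansion_pow Ein_has_fps_expansion)

lemma E_coef_0: "E_coef n 0 = (if n = 0 then 1 else 0)"
  by (simp add: E_coef_eq)

text \<open>Ein has no constant term, so its m-th power starts at z^m. This is why the sum over n in
  the theorem may begin at m.\<close>

lemma E_coef_eq_0: "n < m \<Longrightarrow> E_coef n m = 0"
  unfolding E_coef_eq using startsby_zero_power_prefix[OF Ein_fps_0, of m] by blast

text \<open>Coefficients of z d/dz Ein^(m+1) = (m+1) Ein^m (1 - exp(-z)). On the transform side the
  factor exp(-z) is the shift of u by -1, so the convolution appearing here is exactly the one in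
  the Taylor expansion of a shifted term.\<close>

lemma E_coef_rec:
  "real n * E_coef n (Suc m) =
     real (Suc m) * (E_coef n m - (\<Sum>i\<le>n. (-1) ^ i / fact i * E_coef (n - i) m))"
proof -
  have "fps_X * fps_deriv (Ein_fps ^ Suc m) =
     fps_const (real (Suc m)) * (Ein_fps ^ m * (fps_X * fps_deriv Ein_fps))"
    by (subst fps_deriv_power) (simp add: mult_ac)
  also have "\<dots> = fps_const (real (Suc m)) * (Ein_fps ^ m - fps_exp (-1) * Ein_fps ^ m)"
    unfolding fps_X_deriv_Ein_fps by (simp add: algebra_simps)
  finally have "fps_nth (fps_X * fps_deriv (Ein_fps ^ Suc m)) n = fps_nth \<dots> n" by simp
  moreover have "fps_nth (fps_X * fps_deriv (Ein_fps ^ Suc m)) n = real n * E_coef n (Suc m)"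
    by (cases n) (simp_all add: E_coef_eq del: power_Suc)
  moreover have "fps_nth (fps_exp (-1) * Ein_fps ^ m) n = (\<Sum>i\<le>n. (-1) ^ i / fact i * E_coef (n - i) m)"
    by (simp add: fps_mult_nth E_coef_eq atLeast0AtMost)
  ultimately show ?thesis by (simp add: E_coef_eq)
qed

section \<open>The Taylor series of Gamma through logarithmic moments\<close>

lemma Gamma_set_integral:
  assumes "a > (0::real)"
  shows "integrable lborel (\<lambda>t. indicator {0<..} t * (exp (- t) * t powr (a - 1)))"
    and "(\<integral>t. indicator {0<..} t * (exp (- t) * t powr (a - 1)) \<partial>lborel) = Gamma a"
proof -
  let ?f = "\<lambda>t::real. indicator {0<..} t * (exp (- t) * t powr (a - 1))"
  have "(\<integral>\<^sup>+t. ennreal (?f t) \<partial>lborel) = (\<integral>\<^sup>+t. ennreal (indicator {0..} t * t powr (a - 1) / exp t) \<partial>lborel)"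
    by (intro nn_integral_cong) (auto simp: indicator_def exp_minus field_simps)
  also have "\<dots> = ennreal (Gamma a)" by (rule Gamma_conv_nn_integral_real[OF assms, symmetric])
  finally have *: "has_bochner_integral lborel ?f (Gamma a)"
    by (intro has_bochner_integral_nn_integral) (use assms in \<open>auto simp: Gamma_real_pos less_imp_le\<close>)
  then show "integrable lborel ?f" "integral\<^sup>L lborel ?f = Gamma a"
    by (auto simp: has_bochner_integral_iff)
qed

text \<open>exp(a |ln t|) is at most t^a + t^(-a), and both pieces are Gamma integrals because a <
  1. This dominates every interchange of sum and integral below.\<close>

lemma exp_abs_ln_integrable:
  assumes "0 \<le> a" "a < (1::real)"
  shows "integrable lborel (\<lambda>t. indicator {0<..} t * (exp (- t) * exp (a * \<bar>ln t\<bar>)))"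
proof (rule Bochner_Integration.integrable_bound)
  show "integrable lborel (\<lambda>t. indicator {0<..} t * (exp (- t) * t powr (1 + a - 1))
           + indicator {0<..} t * (exp (- t) * t powr (1 - a - 1)))"
    by (intro Bochner_Integration.integrable_add Gamma_set_integral) (use assms in auto)
  show "AE t in lborel. norm (indicator {0<..} t * (exp (- t) * exp (a * \<bar>ln t\<bar>)))
      \<le> norm (indicator {0<..} t * (exp (- t) * t powr (1 + a - 1))
           + indicator {0<..} t * (exp (- t) * t powr (1 - a - 1)))"
  proof (rule AE_I2)
    fix t :: real
    have "exp (a * \<bar>ln t\<bar>) \<le> t powr a + t powr (- a)" if "t > 0"
      using that by (cases "ln t \<ge> 0") (auto simp: powr_def)
    then show "norm (indicator {0<..} t * (exp (- t) * exp (a * \<bar>ln t\<bar>)))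
      \<le> norm (indicator {0<..} t * (exp (- t) * t powr (1 + a - 1))
           + indicator {0<..} t * (exp (- t) * t powr (1 - a - 1)))"
      by (auto simp: indicator_def distrib_left[symmetric] abs_mult)
  qed
qed simp

lemma pow_div_fact_le_exp:
  assumes "x \<ge> (0::real)" shows "x ^ k / fact k \<le> exp x"
proof -
  have "sum (\<lambda>n. x ^ n /\<^sub>R fact n) {k} \<le> (\<Sum>n. x ^ n /\<^sub>R fact n)"
    using assms by (intro sum_le_suminf summable_exp_generic) auto
  then show ?thesis by (simp add: exp_def field_simps)
qed

lemma exp_ln_power_integrable:
  "integrable lborel (\<lambda>t::real. indicator {0<..} t * (exp (- t) * ln t ^ k))"
proof (rule Bochner_Integration.integrable_bound)
  show "integrable lborel (\<lambda>t::real. 2 ^ k * fact k * (indicator {0<..} t * (exp (- t) * exp (1/2 * \<bar>ln t\<bar>))))"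
    by (intro integrable_mult_right exp_abs_ln_integrable) auto
  show "AE t::real in lborel. norm (indicator {0<..} t * (exp (- t) * ln t ^ k))
      \<le> norm (2 ^ k * fact k * (indicator {0<..} t * (exp (- t) * exp (1/2 * \<bar>ln t\<bar>))))"
  proof (rule AE_I2)
    fix t :: real
    have "\<bar>ln t\<bar> ^ k \<le> 2 ^ k * fact k * exp (1/2 * \<bar>ln t\<bar>)"
      using pow_div_fact_le_exp[of "1/2 * \<bar>ln t\<bar>" k] by (simp add: field_simps)
    then have "exp (- t) * \<bar>ln t\<bar> ^ k \<le> exp (- t) * (2 ^ k * fact k * exp (1/2 * \<bar>ln t\<bar>))"
      by (intro mult_left_mono) auto
    then show "norm (indicator {0<..} t * (exp (- t) * ln t ^ k))
      \<le> norm (2 ^ k * fact k * (indicator {0<..} t * (exp (- t) * exp (1/2 * \<bar>ln t\<bar>))))"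
      by (auto simp: indicator_def abs_mult power_abs mult_ac)
  qed
qed simp

text \<open>\<open>ln_moment k\<close> is the \<open>k\<close>-th derivative of \<open>\<Gamma>\<close> at \<open>1\<close>.\<close>

definition ln_moment :: "nat \<Rightarrow> real" where
  "ln_moment k = (\<integral>t. indicator {0<..} t * (exp (- t) * ln t ^ k) \<partial>lborel)"

text \<open>Expand t^(-z) = exp(-z ln t) and integrate termwise; the absolute partial sums stay
  below exp(|z| |ln t|).\<close>

lemma Gamma_ln_moment_sums:
  assumes "\<bar>z\<bar> < (1::real)"
  shows "(\<lambda>k. (-1) ^ k * ln_moment k / fact k * z ^ k) sums Gamma (1 - z)"
proof -
  define f where "f = (\<lambda>k (t::real). (- z) ^ k / fact k * (indicator {0<..} t * (exp (- t) * ln t ^ k)))"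
  have int: "integrable lborel (f k)" for k
    unfolding f_def by (intro integrable_mult_right exp_ln_power_integrable)
  have f_alt: "f k t = indicator {0<..} t * exp (- t) * ((- z * ln t) ^ k /\<^sub>R fact k)" for k t
    unfolding power_mult_distrib f_def by (simp add: divide_simps)
  have norm_f: "norm (f k t) = indicator {0<..} t * exp (- t) * ((\<bar>z\<bar> * \<bar>ln t\<bar>) ^ k /\<^sub>R fact k)" for k t
    by (simp add: f_alt abs_mult power_abs power_mult_distrib)
  have sum_f: "summable (\<lambda>k. norm (f k t))" for t
    unfolding norm_f by (intro summable_mult summable_exp_generic)
  have bound: "(\<Sum>k<n. norm (f k t)) \<le> indicator {0<..} t * (exp (- t) * exp (\<bar>z\<bar> * \<bar>ln t\<bar>))" for n t
  proof -
    have "(\<Sum>k<n. (\<bar>z\<bar> * \<bar>ln t\<bar>) ^ k /\<^sub>R fact k) \<le> exp (\<bar>z\<bar> * \<bar>ln t\<bar>)"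
      unfolding exp_def by (intro sum_le_suminf summable_exp_generic) auto
    then have "indicator {0<..} t * exp (- t) * (\<Sum>k<n. (\<bar>z\<bar> * \<bar>ln t\<bar>) ^ k /\<^sub>R fact k)
        \<le> indicator {0<..} t * exp (- t) * exp (\<bar>z\<bar> * \<bar>ln t\<bar>)"
      by (intro mult_left_mono) auto
    then show ?thesis unfolding norm_f by (simp add: sum_distrib_left mult.assoc)
  qed
  have sums_norm: "summable (\<lambda>k. \<integral>t. norm (f k t) \<partial>lborel)"
  proof (rule summableI_nonneg_bounded)
    fix n
    have "(\<Sum>k<n. \<integral>t. norm (f k t) \<partial>lborel) = (\<integral>t. (\<Sum>k<n. norm (f k t)) \<partial>lborel)"
      by (subst Bochner_Integration.integral_sum) (auto intro: int)
    also have "\<dots> \<le> (\<integral>t. indicator {0<..} t * (exp (- t) * exp (\<bar>z\<bar> * \<bar>ln t\<bar>)) \<partial>lborel)"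
      by (intro integral_mono bound exp_abs_ln_integrable Bochner_Integration.integrable_sum integrable_norm int)
         (use assms in auto)
    finally show "(\<Sum>k<n. \<integral>t. norm (f k t) \<partial>lborel) \<le> \<dots>" .
  qed simp
  have "(\<lambda>k. integral\<^sup>L lborel (f k)) sums (\<integral>t. (\<Sum>k. f k t) \<partial>lborel)"
    by (rule sums_integral) (use int sum_f sums_norm in auto)
  also have "(\<lambda>t. \<Sum>k. f k t) = (\<lambda>t. indicator {0<..} t * (exp (- t) * t powr (1 - z - 1)))"
  proof
    fix t :: real
    have "(\<Sum>k. f k t) = indicator {0<..} t * exp (- t) * exp (- z * ln t)"
      unfolding f_alt exp_def by (rule suminf_mult) (rule summable_exp_generic)
    then show "(\<Sum>k. f k t) = indicator {0<..} t * (exp (- t) * t powr (1 - z - 1))"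
      by (auto simp: powr_def indicator_def)
  qed
  also have "(\<integral>t. indicator {0<..} t * (exp (- t) * t powr (1 - z - 1)) \<partial>lborel) = Gamma (1 - z)"
    by (rule Gamma_set_integral) (use assms in auto)
  also have "(\<lambda>k. integral\<^sup>L lborel (f k)) = (\<lambda>k. (-1) ^ k * ln_moment k / fact k * z ^ k)"
  proof
    fix k
    have "(- z) ^ k = (-1) ^ k * z ^ k" by (simp add: power_mult_distrib[symmetric])
    then show "integral\<^sup>L lborel (f k) = (-1) ^ k * ln_moment k / fact k * z ^ k"
      by (simp add: f_def ln_moment_def)
  qed
  finally show ?thesis .
qed

definition Gamma_fps :: "real fps" where
  "Gamma_fps = Abs_fps (\<lambda>k. (-1) ^ k * ln_moment k / fact k)"

lemma Gamma_has_fps_expansion: "(\<lambda>z. Gamma (1 - z)) has_fps_expansion Gamma_fps"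
proof -
  \<comment> \<open>Any nonzero point of (-1, 1) would do: convergence there makes the radius
    positive.\<close>
  have "fps_conv_radius Gamma_fps \<ge> norm (1/2::real)"
    unfolding fps_conv_radius_def
    by (rule conv_radius_geI) (use Gamma_ln_moment_sums[of "1/2"] in \<open>auto simp: Gamma_fps_def sums_iff\<close>)
  moreover have "0 < ereal (norm (1/2::real))" by simp
  ultimately have "fps_conv_radius Gamma_fps > 0" using less_le_trans by blast
  moreover have "eventually (\<lambda>z::real. \<bar>z\<bar> < 1) (nhds 0)"
    by (rule eventually_nhds_in_open[of "{-1<..<1}", THEN eventually_mono]) auto
  then have "eventually (\<lambda>z. eval_fps Gamma_fps z = Gamma (1 - z)) (nhds 0)"
    by eventually_elim (use Gamma_ln_moment_sums in \<open>auto simp: eval_fps_def Gamma_fps_def sums_iff\<close>)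
  ultimately show ?thesis by (simp add: has_fps_expansion_def)
qed

lemma Gamma_fps_0: "fps_nth Gamma_fps 0 = 1"
  using has_fps_expansion_at_0[OF Gamma_has_fps_expansion, symmetric] by (simp only: diff_zero Gamma_1)

lemma ln_moment_1: "ln_moment 1 = - euler_mascheroni"
proof -
  have "((\<lambda>z::real. Gamma (1 - z)) has_real_derivative euler_mascheroni) (at 0)"
    by (rule derivative_eq_intros refl | simp)+
  then have "deriv (\<lambda>z::real. Gamma (1 - z)) 0 = euler_mascheroni" by (rule DERIV_imp_deriv)
  then show ?thesis
    using fps_nth_real_expansion[OF Gamma_has_fps_expansion, of 1] by (simp add: Gamma_fps_def)
qed

text \<open>Follows 1/\<Gamma>(\<kappa>+2-z) = 1/((\<kappa>+1-z) \<Gamma>(\<kappa>+1-z)), so that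
  only \<Gamma>(1-z) has to be inverted as a series and the recursion in \<kappa> is built
  in.\<close>

primrec C_fps :: "nat \<Rightarrow> real fps" where
  "C_fps 0 = fps_exp euler_mascheroni * inverse Gamma_fps"
| "C_fps (Suc \<kappa>) = C_fps \<kappa> * inverse (fps_const (real (Suc \<kappa>)) - fps_X)"

lemma C_has_fps_expansion:
  "(\<lambda>z::real. exp (euler_mascheroni * z) * rGamma (real \<kappa> + 1 - z)) has_fps_expansion C_fps \<kappa>"
proof (induction \<kappa>)
  case 0
  have "(\<lambda>z::real. exp (euler_mascheroni * z) * inverse (Gamma (1 - z))) has_fps_expansion C_fps 0"
    unfolding C_fps.simps
    by (rule has_fps_expansion_mult[OF has_fps_expansion_exp
          has_fps_expansion_inverse[OF Gamma_has_fps_expansion]]) (simp add: Gamma_fps_0)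
  then show ?case by (simp add: rGamma_inverse_Gamma)
next
  case (Suc \<kappa>)
  let ?f = "\<lambda>\<kappa> (z::real). exp (euler_mascheroni * z) * rGamma (real \<kappa> + 1 - z)"
  have "(\<lambda>z. ?f \<kappa> z * inverse (real (Suc \<kappa>) - z)) has_fps_expansion C_fps (Suc \<kappa>)"
    unfolding C_fps.simps
    by (rule has_fps_expansion_mult[OF Suc has_fps_expansion_inverse[OF
          has_fps_expansion_diff[OF has_fps_expansion_const has_fps_expansion_fps_X]]]) auto
  moreover have "eventually (\<lambda>z::real. \<bar>z\<bar> < 1) (nhds 0)"
    by (rule eventually_nhds_in_open[of "{-1<..<1}", THEN eventually_mono]) auto
  then have "eventually (\<lambda>z. ?f \<kappa> z * inverse (real (Suc \<kappa>) - z) = ?f (Suc \<kappa>) z) (nhds 0)"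
  proof eventually_elim
    case (elim z)
    have "(real \<kappa> + 1 - z) * rGamma (real \<kappa> + 1 - z + 1) = rGamma (real \<kappa> + 1 - z)"
      by (rule rGamma_plus1)
    moreover have "real \<kappa> + 1 - z \<noteq> 0" using elim by linarith
    ultimately show ?case by (simp add: field_simps)
  qed
  ultimately show ?case
    by (auto simp: has_fps_expansion_def elim: eventually_elim2)
qed

lemma C_coef_eq: "C_coef r \<kappa> = fps_nth (C_fps \<kappa>) r"
  unfolding C_coef_def by (rule fps_nth_real_expansion[OF C_has_fps_expansion])

lemma C_coef_rec: "C_coef r \<kappa> = real (Suc \<kappa>) * C_coef r (Suc \<kappa>) - (if r = 0 then 0 else C_coef (r - 1) (Suc \<kappa>))"
proof -
  have "C_fps \<kappa> = (fps_const (real (Suc \<kappa>)) - fps_X) * C_fps (Suc \<kappa>)"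
  proof -
    let ?P = "fps_const (real (Suc \<kappa>)) - fps_X"
    have "?P * inverse ?P = 1" by (rule inverse_mult_eq_1') simp
    then show ?thesis unfolding C_fps.simps by (simp only: mult.left_commute mult_1_right)
  qed
  also have "\<dots> = fps_const (real (Suc \<kappa>)) * C_fps (Suc \<kappa>) - fps_X * C_fps (Suc \<kappa>)"
    by (simp only: left_diff_distrib)
  finally have "fps_nth (C_fps \<kappa>) r = fps_nth \<dots> r" by (rule arg_cong)
  then show ?thesis unfolding C_coef_eq by (cases r) (auto simp del: C_fps.simps)
qed

lemma C_coef_0: "C_coef 0 \<kappa> = 1 / fact \<kappa>"
proof -
  have "C_coef 0 \<kappa> = rGamma (1 + real \<kappa>)" by (simp add: C_coef_def add.commute)
  then show ?thesis by (simp add: rGamma_inverse_Gamma Gamma_fact field_simps)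
qed

text \<open>The product of exp(\<gamma> z)/\<Gamma>(1-z) and \<Gamma>(1-z), with z replaced by -z.
  It makes the transform of the leading term collapse to a pure power of -\<gamma> - ln s.\<close>

lemma C_coef_ln_moment:
  "(\<Sum>r\<le>k. (-1) ^ r * C_coef r 0 * ln_moment (k - r) / fact (k - r)) = (- euler_mascheroni) ^ k / fact k"
proof -
  have "C_fps 0 * Gamma_fps = fps_exp euler_mascheroni"
  proof -
    have "inverse Gamma_fps * Gamma_fps = 1" by (rule inverse_mult_eq_1) (simp add: Gamma_fps_0)
    then show ?thesis by (simp only: C_fps.simps mult.assoc mult_1_right)
  qed
  then have "fps_nth (C_fps 0 * Gamma_fps) k = euler_mascheroni ^ k / fact k" by (simp del: C_fps.simps)
  then have "(\<Sum>r\<le>k. C_coef r 0 * ((-1) ^ (k - r) * ln_moment (k - r) / fact (k - r))) = euler_mascheroni ^ k / fact k"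
    by (simp add: fps_mult_nth C_coef_eq Gamma_fps_def atLeast0AtMost del: C_fps.simps)
  then have "(-1) ^ k * (\<Sum>r\<le>k. C_coef r 0 * ((-1) ^ (k - r) * ln_moment (k - r) / fact (k - r)))
       = (- euler_mascheroni) ^ k / fact k"
    by (simp add: power_mult_distrib[symmetric])
  then have "(\<Sum>r\<le>k. (-1) ^ k * (C_coef r 0 * ((-1) ^ (k - r) * ln_moment (k - r) / fact (k - r))))
       = (- euler_mascheroni) ^ k / fact k"
    by (simp only: sum_distrib_left)
  moreover have "(-1) ^ k * (C_coef r 0 * ((-1) ^ (k - r) * ln_moment (k - r) / fact (k - r)))
       = (-1) ^ r * C_coef r 0 * ln_moment (k - r) / fact (k - r)" if "r \<le> k" for r
  proof -
    have "(-1::real) ^ k = (-1) ^ r * (-1) ^ (k - r)"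
      using that by (simp add: power_add[symmetric])
    moreover have "(-1::real) ^ (k - r) * (-1) ^ (k - r) = 1"
      by (simp add: power_mult_distrib[symmetric])
    ultimately show ?thesis by simp
  qed
  ultimately show ?thesis by (metis (no_types, lifting) atMost_iff sum.cong)
qed

section \<open>The asymptotic scale\<close>

text \<open>The coefficient of z^k in b(z) exp(x z), where b(z) has coefficients b. At x = ln u this
  is the coefficient in b(z) u^z, so operations on logarithmic polynomials become multiplications of
  b(z).\<close>

definition logpoly :: "(nat \<Rightarrow> real) \<Rightarrow> nat \<Rightarrow> real \<Rightarrow> real" where
  "logpoly b k x = (\<Sum>r\<le>k. b r * x ^ (k - r) / fact (k - r))"

text \<open>Multiplication of the generating function by z.\<close>

definition shift_seq :: "(nat \<Rightarrow> real) \<Rightarrow> nat \<Rightarrow> real" where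
  "shift_seq b r = (if r = 0 then 0 else b (r - 1))"

lemma logpoly_shift_seq: "logpoly (shift_seq b) k x = (if k = 0 then 0 else logpoly b (k - 1) x)"
  by (cases k) (auto simp: logpoly_def shift_seq_def sum.atMost_Suc_shift simp del: sum.atMost_Suc)

lemma logpoly_linear:
  "logpoly (\<lambda>r. c * b r + d * b' r) k x = c * logpoly b k x + d * logpoly b' k x"
  by (simp add: logpoly_def sum.distrib sum_distrib_left add_divide_distrib distrib_right mult.assoc)

lemma logpoly_deriv: "(logpoly b k has_real_derivative logpoly (shift_seq b) k x) (at x)"
proof -
  have "((\<lambda>x. b r * x ^ (k - r) / fact (k - r)) has_real_derivative
      (if r < k then b r * x ^ (k - 1 - r) / fact (k - 1 - r) else 0)) (at x)" if "r \<le> k" for r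
  proof (cases "r = k")
    case False
    define j where "j = k - 1 - r"
    have j: "k - r = Suc j" using that False by (simp add: j_def)
    have "((\<lambda>x. b r * x ^ Suc j / fact (Suc j)) has_real_derivative b r * (real (Suc j) * x ^ j) / fact (Suc j)) (at x)"
      using DERIV_pow[of "Suc j" x] by (intro DERIV_cdivide DERIV_cmult) simp
    also have "b r * (real (Suc j) * x ^ j) / fact (Suc j) = b r * x ^ j / fact j"
      by (simp add: field_simps del: of_nat_Suc)
    finally show ?thesis using False that unfolding j j_def by simp
  qed simp
  then have "(logpoly b k has_real_derivative
      (\<Sum>r\<le>k. if r < k then b r * x ^ (k - 1 - r) / fact (k - 1 - r) else 0)) (at x)"
    unfolding logpoly_def[abs_def] by (intro DERIV_sum) auto
  also have "(\<Sum>r\<le>k. if r < k then b r * x ^ (k - 1 - r) / fact (k - 1 - r) else 0) =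
      logpoly (shift_seq b) k x"
    unfolding logpoly_shift_seq by (cases k) (auto simp: logpoly_def less_Suc_eq_le)
  finally show ?thesis .
qed

lemma powi_deriv:
  assumes "u > 0" shows "((\<lambda>u. u powi a) has_real_derivative of_int a * u powi (a - 1)) (at u)"
  using has_derivative_power_int'[of u a UNIV] assms
  by (simp add: has_field_derivative_def mult.commute[of _ "of_int a * _"])

text \<open>The derivative of u^(a+z) is (a+z) u^(a+z-1), so b(z) is multiplied by a + z. The factor
  1 keeps the shape of \<open>logpoly_linear\<close>.\<close>

lemma powi_logpoly_deriv:
  assumes "u > 0"
  shows "((\<lambda>u. u powi a * logpoly b k (ln u)) has_real_derivative
     u powi (a - 1) * logpoly (\<lambda>r. of_int a * b r + 1 * shift_seq b r) k (ln u)) (at u)"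
proof -
  note 1 = powi_deriv[OF assms, of a]
  have 2: "((\<lambda>u. logpoly b k (ln u)) has_real_derivative logpoly (shift_seq b) k (ln u) * (1 / u)) (at u)"
    by (rule DERIV_chain2[OF logpoly_deriv]) (use assms in \<open>auto intro!: derivative_eq_intros\<close>)
  have "u powi a = u powi (a - 1) * u"
    using assms power_int_add_1[of u "a - 1"] by simp
  then show ?thesis using assms
    by (intro DERIV_cong[OF DERIV_mult[OF 1 2]]) (simp only: logpoly_linear, simp add: algebra_simps)
qed

text \<open>Each step multiplies by z - j, since 1/\<Gamma>(z-j) = (z-j)/\<Gamma>(z-j+1); the
  reciprocal Gamma function has no poles, so the descent never breaks down.\<close>

primrec phi_coef_neg :: "nat \<Rightarrow> nat \<Rightarrow> real" where
  "phi_coef_neg 0 = (\<lambda>r. (-1) ^ r * C_coef r 0)"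
| "phi_coef_neg (Suc j) = (\<lambda>r. - real j * phi_coef_neg j r + shift_seq (phi_coef_neg j) r)"

text \<open>Coefficients of \<open>z \<mapsto> exp (-\<gamma> z) / \<Gamma>(a + 1 + z)\<close> at \<open>0\<close>, for every integer \<open>a\<close>.\<close>

definition phi_coef :: "int \<Rightarrow> nat \<Rightarrow> real" where
  "phi_coef a = (if a \<ge> 0 then (\<lambda>r. (-1) ^ r * C_coef r (nat a)) else phi_coef_neg (nat (- a)))"

text \<open>The functional equation 1/\<Gamma>(a+z) = (a+z)/\<Gamma>(a+1+z), uniformly in the sign
  of a: for a > 0 it is the recursion of the C coefficients with signs, otherwise it holds by
  construction.\<close>

lemma phi_coef_rec: "phi_coef (a - 1) = (\<lambda>r. of_int a * phi_coef a r + 1 * shift_seq (phi_coef a) r)"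
proof (cases "a > 0")
  case True
  then obtain k where a: "a = int (Suc k)" by (metis gr0_implies_Suc zero_less_imp_eq_int)
  show ?thesis
  proof
    fix r
    show "phi_coef (a - 1) r = of_int a * phi_coef a r + 1 * shift_seq (phi_coef a) r"
      unfolding a
      by (cases r) (auto simp: phi_coef_def shift_seq_def nat_add_distrib C_coef_rec[of _ k] algebra_simps)
  qed
next
  case False
  define j where "j = nat (- a)"
  have a: "a = - int j" using False by (simp add: j_def)
  have "phi_coef (- int j) = phi_coef_neg j" by (cases j) (auto simp: phi_coef_def nat_add_distrib simp del: phi_coef_neg.simps(2))
  moreover have "phi_coef (- int j - 1) = phi_coef_neg (Suc j)"
    by (simp add: phi_coef_def nat_add_distrib del: phi_coef_neg.simps)
  ultimately show ?thesis unfolding a by simp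
qed

text \<open>The inverse Laplace transform of \<open>s^(-a-1) (-\<gamma> - ln s)^k / k!\<close>; differentiation in \<open>u\<close> lowers \<open>a\<close> by one, and multiplication by \<open>u\<close> is \<open>-d/ds\<close> on the transform side.\<close>

definition phi :: "nat \<Rightarrow> int \<Rightarrow> real \<Rightarrow> real" where
  "phi k a u = u powi a * logpoly (phi_coef a) k (ln u)"

lemma phi_deriv: "u > 0 \<Longrightarrow> (phi k a has_real_derivative phi k (a - 1) u) (at u)"
  unfolding phi_def[abs_def] phi_coef_rec[of a] by (rule powi_logpoly_deriv)

lemma phi_mult:
  assumes "u > 0"
  shows "u * phi k a u = of_int (a + 1) * phi k (a + 1) u + (if k = 0 then 0 else phi (k - 1) (a + 1) u)"
proof -
  have "logpoly (phi_coef a) k (ln u) = of_int (a + 1) * logpoly (phi_coef (a + 1)) k (ln u)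
      + (if k = 0 then 0 else logpoly (phi_coef (a + 1)) (k - 1) (ln u))"
    using phi_coef_rec[of "a + 1"] logpoly_linear[of "of_int (a + 1)" "phi_coef (a + 1)" 1 "shift_seq (phi_coef (a + 1))" k "ln u"]
    by (simp only: add_diff_cancel logpoly_shift_seq mult_1)
  moreover have "u powi (a + 1) = u powi a * u" using assms by (simp add: power_int_add_1)
  ultimately show ?thesis unfolding phi_def by (simp add: algebra_simps)
qed

section \<open>Iterated derivatives of powers of the logarithm\<close>

lemma higher_deriv_chain:
  fixes F :: "nat \<Rightarrow> real \<Rightarrow> real"
  assumes "\<And>j u. u > 0 \<Longrightarrow> (F j has_real_derivative F (Suc j) u) (at u)" and "u > 0"
  shows "(deriv ^^ j) (F 0) u = F j u"
  using assms(2)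
proof (induction j arbitrary: u)
  case (Suc j)
  have "eventually (\<lambda>v. v > 0) (nhds u)"
    using Suc.prems eventually_nhds_in_open[of "{0<..}" u] by auto
  then have "eventually (\<lambda>v. (deriv ^^ j) (F 0) v = F j v) (nhds u)"
    by eventually_elim (rule Suc.IH)
  then have "deriv ((deriv ^^ j) (F 0)) u = deriv (F j) u"
    by (intro deriv_cong_ev) auto
  also have "\<dots> = F (Suc j) u"
    using Suc.prems by (intro DERIV_imp_deriv assms(1))
  finally show ?case by simp
qed simp

text \<open>Coefficients of the falling factorial \<open>z (z - 1) \<cdots> (z - j + 1)\<close>: \<open>ln u ^ p / p!\<close> is the coefficient of \<open>z ^ p\<close> in \<open>u powr z\<close>.\<close>

primrec ln_deriv_coef :: "nat \<Rightarrow> nat \<Rightarrow> real" where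
  "ln_deriv_coef 0 = (\<lambda>r. if r = 0 then 1 else 0)"
| "ln_deriv_coef (Suc j) = (\<lambda>r. of_int (- int j) * ln_deriv_coef j r + 1 * shift_seq (ln_deriv_coef j) r)"

lemma ln_deriv_coef_0: "logpoly (ln_deriv_coef 0) p x = x ^ p / fact p"
proof -
  have "logpoly (ln_deriv_coef 0) p x = (\<Sum>r\<le>p. if r = 0 then x ^ p / fact p else 0)"
    unfolding logpoly_def by (intro sum.cong) auto
  then show ?thesis by simp
qed

lemma ln_deriv_coef_deriv:
  assumes "u > 0"
  shows "((\<lambda>u. u powi (- int j) * logpoly (ln_deriv_coef j) p (ln u)) has_real_derivative
     u powi (- int (Suc j)) * logpoly (ln_deriv_coef (Suc j)) p (ln u)) (at u)"
proof -
  have "- int (Suc j) = - int j - 1" by simp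
  then show ?thesis using powi_logpoly_deriv[OF assms, of "- int j" "ln_deriv_coef j" p]
    by (simp only: ln_deriv_coef.simps)
qed

lemma ln_power_higher_deriv:
  assumes "u > 0"
  shows "(deriv ^^ j) (\<lambda>x. ln x ^ p) u = fact p * (u powi (- int j) * logpoly (ln_deriv_coef j) p (ln u))"
proof -
  let ?F = "\<lambda>j u. fact p * (u powi (- int j) * logpoly (ln_deriv_coef j) p (ln u))"
  have "(?F j has_real_derivative ?F (Suc j) u) (at u)" if "u > 0" for j u
    by (intro DERIV_cmult ln_deriv_coef_deriv that)
  from higher_deriv_chain[of ?F, OF this assms] have "(deriv ^^ j) (?F 0) u = ?F j u" .
  moreover have "?F 0 = (\<lambda>x. ln x ^ p)" by (simp add: ln_deriv_coef_0 fun_eq_iff del: ln_deriv_coef.simps)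
  ultimately show ?thesis by simp
qed

text \<open>Both sides are j-th derivatives of the same combination of powers of ln u, computed
  along two chains. This turns the terms with negative exponent into the form demanded by the second
  sum of the theorem.\<close>

lemma phi_neg_eq_higher_deriv:
  assumes "u > 0"
  shows "phi k (- int j) u = (\<Sum>r\<le>k. phi_coef 0 r / fact (k - r) * (deriv ^^ j) (\<lambda>x. ln x ^ (k - r)) u)"
proof -
  have step: "- int (Suc j) = - int j - 1" for j by simp
  let ?P = "\<lambda>j. phi k (- int j)"
  let ?H = "\<lambda>j u. \<Sum>r\<le>k. phi_coef 0 r * (u powi (- int j) * logpoly (ln_deriv_coef j) (k - r) (ln u))"
  have "(?P j has_real_derivative ?P (Suc j) u) (at u)" if "u > 0" for j u
    unfolding step by (rule phi_deriv[OF that])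
  from higher_deriv_chain[of ?P, OF this assms] have "(deriv ^^ j) (?P 0) u = ?P j u" .
  moreover have "(?H j has_real_derivative ?H (Suc j) u) (at u)" if "u > 0" for j u
    by (intro DERIV_sum DERIV_cmult ln_deriv_coef_deriv that)
  from higher_deriv_chain[of ?H, OF this assms] have "(deriv ^^ j) (?H 0) u = ?H j u" .
  moreover have "?H 0 = ?P 0"
    by (simp add: fun_eq_iff phi_def ln_deriv_coef_0 logpoly_def[of "phi_coef 0"] del: ln_deriv_coef.simps)
  ultimately have "?P j u = ?H j u" by simp
  also have "\<dots> = (\<Sum>r\<le>k. phi_coef 0 r / fact (k - r) * (deriv ^^ j) (\<lambda>x. ln x ^ (k - r)) u)"
    by (simp add: ln_power_higher_deriv[OF assms])
  finally show ?thesis .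
qed

text \<open>The candidate without the factor \<kappa>!, with Ein^m cut off after s^N. The parameter
  \<kappa> is an integer so that differentiation may lower it to -1.\<close>

definition expansion :: "nat \<Rightarrow> int \<Rightarrow> nat \<Rightarrow> real \<Rightarrow> real" where
  "expansion l \<kappa> N u = (\<Sum>m\<le>l. \<Sum>n\<le>N. E_coef n m / fact m * phi (l - m) (\<kappa> - int n) u)"

text \<open>The Taylor expansion of \<open>expansion l \<kappa> N (u - 1)\<close> around \<open>u\<close>, truncated at total order \<open>N\<close>.\<close>

definition expansion_shift :: "nat \<Rightarrow> int \<Rightarrow> nat \<Rightarrow> real \<Rightarrow> real" where
  "expansion_shift l \<kappa> N u = (\<Sum>m\<le>l. \<Sum>n\<le>N.
      (\<Sum>i\<le>n. (-1) ^ i / fact i * E_coef (n - i) m) / fact m * phi (l - m) (\<kappa> - int n) u)"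

lemma expansion_deriv: "u > 0 \<Longrightarrow> (expansion l \<kappa> N has_real_derivative expansion l (\<kappa> - 1) N u) (at u)"
proof -
  assume u: "u > 0"
  have "(phi k (\<kappa> - int n) has_real_derivative phi k (\<kappa> - 1 - int n) u) (at u)" for k n
    using phi_deriv[OF u, of k "\<kappa> - int n"] by (simp add: algebra_simps)
  then show ?thesis unfolding expansion_def[abs_def]
    by (intro DERIV_sum DERIV_cmult)
qed

text \<open>Exact in spite of the truncation, since no operation mixes different n. Multiplying a
  term by u yields the factor \<kappa>+1-n and a copy with one logarithm less; the part with -n is
  rewritten by \<open>E_coef_rec\<close>, the E_{n,m} cancel, and the shifted coefficients
  remain.\<close>

lemma expansion_rec:
  assumes u: "u > 0"
  shows "u * expansion (Suc l) \<kappa> N u = of_int (\<kappa> + 1) * expansion (Suc l) (\<kappa> + 1) N u + expansion_shift l (\<kappa> + 1) N u"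
proof -
  define e where "e = (\<lambda>n m. E_coef n m / fact m)"
  define t where "t = (\<lambda>n m. (\<Sum>i\<le>n. (-1) ^ i / fact i * E_coef (n - i) m) / fact m)"
  define f where "f = (\<lambda>k n. phi k (\<kappa> + 1 - int n) u)"
  have rec: "real n * e n (Suc m) = e n m - t n m" for n m
  proof -
    have "real n * e n (Suc m) = (real n * E_coef n (Suc m)) / fact (Suc m)" by (simp add: e_def)
    also have "\<dots> = e n m - t n m"
      unfolding E_coef_rec by (simp add: e_def t_def diff_divide_distrib del: of_nat_Suc)
    finally show ?thesis .
  qed
  have rec0: "real n * e n 0 = 0" for n by (simp add: e_def E_coef_0)
  have mul: "u * phi k (\<kappa> - int n) u = (of_int (\<kappa> + 1) - real n) * f k n + (if k = 0 then 0 else f (k - 1) n)" for k n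
    using phi_mult[OF u, of k "\<kappa> - int n"] by (simp add: f_def algebra_simps)
  have "u * expansion (Suc l) \<kappa> N u = (\<Sum>m\<le>Suc l. \<Sum>n\<le>N. e n m * (u * phi (Suc l - m) (\<kappa> - int n) u))"
    unfolding expansion_def e_def by (simp add: sum_distrib_left mult_ac del: sum.atMost_Suc)
  also have "\<dots> = (\<Sum>m\<le>Suc l. \<Sum>n\<le>N. of_int (\<kappa> + 1) * (e n m * f (Suc l - m) n)
       - real n * e n m * f (Suc l - m) n + e n m * (if Suc l - m = 0 then 0 else f (Suc l - m - 1) n))"
    unfolding mul by (intro sum.cong refl) (simp add: algebra_simps)
  also have "\<dots> = of_int (\<kappa> + 1) * (\<Sum>m\<le>Suc l. \<Sum>n\<le>N. e n m * f (Suc l - m) n)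
       - (\<Sum>m\<le>Suc l. \<Sum>n\<le>N. real n * e n m * f (Suc l - m) n)
       + (\<Sum>m\<le>Suc l. \<Sum>n\<le>N. e n m * (if Suc l - m = 0 then 0 else f (Suc l - m - 1) n))"
    by (simp only: sum.distrib sum_subtractf sum_distrib_left)
  \<comment> \<open>The term m = 0 drops out because n E_{n,0} = 0 for every n; this allows the
    reindexing by m+1.\<close>
  also have "(\<Sum>m\<le>Suc l. \<Sum>n\<le>N. real n * e n m * f (Suc l - m) n)
      = (\<Sum>m\<le>l. \<Sum>n\<le>N. (e n m - t n m) * f (l - m) n)"
    unfolding sum.atMost_Suc_shift[of _ l] rec rec0 by simp
  also have "(\<Sum>m\<le>Suc l. \<Sum>n\<le>N. e n m * (if Suc l - m = 0 then 0 else f (Suc l - m - 1) n))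
      = (\<Sum>m\<le>l. \<Sum>n\<le>N. e n m * f (l - m) n)"
    by (simp add: Suc_diff_le)
  finally have "u * expansion (Suc l) \<kappa> N u = of_int (\<kappa> + 1) * (\<Sum>m\<le>Suc l. \<Sum>n\<le>N. e n m * f (Suc l - m) n)
       + (\<Sum>m\<le>l. \<Sum>n\<le>N. t n m * f (l - m) n)"
    by (simp add: left_diff_distrib sum_subtractf del: sum.atMost_Suc)
  then show ?thesis unfolding expansion_def expansion_shift_def e_def t_def f_def .
qed

section \<open>Growth estimates and the shift by one\<close>

lemma phi_bound:
  assumes "u \<ge> exp 1"
  shows "\<bar>phi k a u\<bar> \<le> (\<Sum>r\<le>k. \<bar>phi_coef a r\<bar>) * (ln u ^ k * u powi a)"
proof -
  have "u > 0" using assms less_le_trans[OF exp_gt_zero] by blast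
  then have ln: "ln u \<ge> 1" using assms by (simp add: ln_ge_iff)
  have "\<bar>logpoly (phi_coef a) k (ln u)\<bar> \<le> (\<Sum>r\<le>k. \<bar>phi_coef a r * ln u ^ (k - r) / fact (k - r)\<bar>)"
    unfolding logpoly_def by (rule sum_abs)
  also have "\<dots> \<le> (\<Sum>r\<le>k. \<bar>phi_coef a r\<bar> * ln u ^ k)"
  proof (rule sum_mono)
    fix r assume "r \<in> {..k}"
    have "ln u ^ (k - r) / fact (k - r) \<le> ln u ^ (k - r) / 1"
      using ln by (intro divide_left_mono) (auto simp: fact_ge_1)
    also have "\<dots> \<le> ln u ^ k" using ln by (simp add: power_increasing)
    finally have "\<bar>phi_coef a r\<bar> * (ln u ^ (k - r) / fact (k - r)) \<le> \<bar>phi_coef a r\<bar> * ln u ^ k"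
      by (intro mult_left_mono) auto
    then show "\<bar>phi_coef a r * ln u ^ (k - r) / fact (k - r)\<bar> \<le> \<bar>phi_coef a r\<bar> * ln u ^ k"
      using ln by (simp add: abs_mult)
  qed
  finally have "u powi a * \<bar>logpoly (phi_coef a) k (ln u)\<bar> \<le> u powi a * ((\<Sum>r\<le>k. \<bar>phi_coef a r\<bar>) * ln u ^ k)"
    using \<open>u > 0\<close> by (intro mult_left_mono) (auto simp: sum_distrib_right)
  then show ?thesis unfolding phi_def using \<open>u > 0\<close> by (simp add: abs_mult mult_ac)
qed

lemma powi_le_half:
  fixes t u :: real
  assumes "u > 0" "u / 2 \<le> t" "t \<le> u"
  shows "t powi a \<le> 2 ^ nat \<bar>a\<bar> * u powi a"
proof (cases "a \<ge> 0")
  case True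
  then obtain n where a: "a = int n" using nonneg_int_cases by blast
  have "t ^ n \<le> u ^ n" using assms by (intro power_mono) auto
  also have "\<dots> \<le> 2 ^ n * u ^ n" using assms by simp
  finally show ?thesis by (simp add: a)
next
  case False
  define n where "n = nat (- a)"
  have a: "a = - int n" using False by (simp add: n_def)
  have "(1 / t) ^ n \<le> (2 / u) ^ n" using assms by (intro power_mono) (auto simp: field_simps)
  then show ?thesis by (simp add: a power_int_minus power_divide field_simps)
qed

lemma ln_powi_bigo:
  assumes "k \<le> l" shows "(\<lambda>u::real. ln u ^ k * u powi a) \<in> O(\<lambda>u. ln u ^ l * u powi a)"
proof (rule bigoI[where c = 1])
  have "eventually (\<lambda>u::real. u \<ge> exp 1) at_top" by (rule eventually_ge_at_top)
  then show "eventually (\<lambda>u::real. norm (ln u ^ k * u powi a) \<le> 1 * norm (ln u ^ l * u powi a)) at_top"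
  proof eventually_elim
    case (elim u)
    then have "u > 0" using less_le_trans[OF exp_gt_zero] by blast
    then have "ln u \<ge> 1" using elim by (simp add: ln_ge_iff)
    then show ?case using assms by (auto simp: abs_mult intro!: mult_right_mono power_increasing)
  qed
qed

lemma bigo_cmult: "f \<in> O[F](g) \<Longrightarrow> (\<lambda>x. c * f x) \<in> O[F](g)" for c :: real
  by (cases "c = 0") simp_all

text \<open>Taylor's formula with step -1; successive derivatives only lower the exponent. The
  Lagrange remainder sits at some t between u - 1 and u, where powers of t and u are
  comparable.\<close>

lemma phi_shift:
  "(\<lambda>u. phi k a (u - 1) - (\<Sum>i\<le>p. (-1) ^ i / fact i * phi k (a - int i) u))
     \<in> O(\<lambda>u. ln u ^ k * u powi (a - int p - 1))"
proof -
  define b where "b = a - int p - 1"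
  define B where "B = (\<Sum>r\<le>k. \<bar>phi_coef b r\<bar>)"
  have "B \<ge> 0" by (simp add: B_def sum_nonneg)
  \<comment> \<open>Large enough for both u - 1 \<ge> u/2, needed by \<open>powi_le_half\<close>,
    and u - 1 \<ge> e, needed by \<open>phi_bound\<close>.\<close>
  have "eventually (\<lambda>u::real. u \<ge> 2 + 2 * exp 1) at_top" by (rule eventually_ge_at_top)
  then have "eventually (\<lambda>u. norm (phi k a (u - 1) - (\<Sum>i\<le>p. (-1) ^ i / fact i * phi k (a - int i) u))
     \<le> (B * 2 ^ nat \<bar>b\<bar>) * norm (ln u ^ k * u powi b)) at_top"
  proof eventually_elim
    case (elim u)
    have "exp 1 > (0::real)" by simp
    with elim have u: "u > 2" "u - 1 \<ge> exp 1" by linarith+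
    obtain t where t: "u - 1 < t" "t < u" and
      eq: "phi k a (u - 1) = (\<Sum>m<Suc p. phi k (a - int m) u / fact m * (u - 1 - u) ^ m)
        + phi k (a - int (Suc p)) t / fact (Suc p) * (u - 1 - u) ^ Suc p"
    proof -
      have step: "a - int (Suc m) = a - int m - 1" for m by simp
      have "\<forall>m t. m < Suc p \<and> u - 1 \<le> t \<and> t \<le> u \<longrightarrow>
          (phi k (a - int m) has_real_derivative phi k (a - int (Suc m)) t) (at t)"
        unfolding step using phi_deriv[of _ k] u by auto
      from Taylor_down[of "Suc p" "\<lambda>m. phi k (a - int m)" "phi k a", OF _ _ this, of u]
      show ?thesis using that by (auto simp del: sum.lessThan_Suc fact_Suc of_nat_Suc power_Suc)
    qed
    have b: "a - int (Suc p) = b" by (simp add: b_def)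
    have "phi k a (u - 1) - (\<Sum>i\<le>p. (-1) ^ i / fact i * phi k (a - int i) u)
        = phi k b t / fact (Suc p) * (-1) ^ Suc p"
      unfolding eq lessThan_Suc_atMost b by (simp add: mult_ac del: fact_Suc power_Suc)
    then have "norm (phi k a (u - 1) - (\<Sum>i\<le>p. (-1) ^ i / fact i * phi k (a - int i) u)) = \<bar>phi k b t\<bar> / fact (Suc p)"
      by (simp add: abs_mult del: fact_Suc power_Suc)
    also have "\<dots> \<le> \<bar>phi k b t\<bar> / 1"
      by (intro divide_left_mono) (auto simp: fact_ge_1 simp del: fact_Suc)
    also have "\<dots> \<le> B * (ln t ^ k * t powi b)"
      using phi_bound[of t k b] t u by (simp add: B_def)
    also have "\<dots> \<le> B * (ln u ^ k * (2 ^ nat \<bar>b\<bar> * u powi b))"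
      using t u \<open>B \<ge> 0\<close> by (intro mult_left_mono mult_mono power_mono powi_le_half) auto
    finally show ?case using u by (simp add: abs_mult mult_ac)
  qed
  then show ?thesis unfolding b_def by (rule bigoI)
qed

text \<open>Reindexing the Cauchy product over the triangle of total order N: the term of index n
  receives its own Taylor polynomial, of degree N - n.\<close>

lemma expansion_shift_eq:
  "expansion_shift l \<kappa> N u = (\<Sum>m\<le>l. \<Sum>n\<le>N. E_coef n m / fact m *
      (\<Sum>i\<le>N - n. (-1) ^ i / fact i * phi (l - m) (\<kappa> - int n - int i) u))"
proof -
  have tri: "(\<Sum>n\<le>N. \<Sum>i\<le>n. g i (n - i)) = (\<Sum>n\<le>N. \<Sum>i\<le>N - n. g i n)" for g :: "nat \<Rightarrow> nat \<Rightarrow> real"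
  proof -
    have "(\<Sum>n\<le>N. \<Sum>i\<le>n. g i (n - i)) = (\<Sum>(i,j)\<in>{(i,j). i + j \<le> N}. g i j)"
      by (rule sum.triangle_reindex_eq[symmetric])
    also have "\<dots> = (\<Sum>(j,i)\<in>Sigma {..N} (\<lambda>j. {..N - j}). g i j)"
      by (rule sum.reindex_bij_witness[of _ prod.swap prod.swap]) auto
    finally show ?thesis by (simp add: sum.Sigma)
  qed
  show ?thesis unfolding expansion_shift_def
  proof (rule sum.cong[OF refl])
    fix m
    have "(\<Sum>n\<le>N. (\<Sum>i\<le>n. (-1) ^ i / fact i * E_coef (n - i) m) / fact m * phi (l - m) (\<kappa> - int n) u)
      = (\<Sum>n\<le>N. \<Sum>i\<le>n. (\<lambda>i j. E_coef j m / fact m * ((-1) ^ i / fact i * phi (l - m) (\<kappa> - int j - int i) u)) i (n - i))"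
      by (intro sum.cong refl) (auto simp: sum_distrib_left sum_distrib_right sum_divide_distrib algebra_simps of_nat_diff intro!: sum.cong)
    also have "\<dots> = (\<Sum>n\<le>N. \<Sum>i\<le>N - n. E_coef n m / fact m * ((-1) ^ i / fact i * phi (l - m) (\<kappa> - int n - int i) u))"
      by (rule tri)
    finally show "(\<Sum>n\<le>N. (\<Sum>i\<le>n. (-1) ^ i / fact i * E_coef (n - i) m) / fact m * phi (l - m) (\<kappa> - int n) u)
      = (\<Sum>n\<le>N. E_coef n m / fact m * (\<Sum>i\<le>N - n. (-1) ^ i / fact i * phi (l - m) (\<kappa> - int n - int i) u))"
      by (simp only: sum_distrib_left)
  qed
qed

text \<open>The degree N - n for the term of exponent \<kappa> - n makes all Taylor remainders have
  the same exponent \<kappa> - N - 1.\<close>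

lemma expansion_shift_bigo:
  "(\<lambda>u. expansion l \<kappa> N (u - 1) - expansion_shift l \<kappa> N u) \<in> O(\<lambda>u. ln u ^ l * u powi (\<kappa> - int N - 1))"
proof -
  have "(\<lambda>u. expansion l \<kappa> N (u - 1) - expansion_shift l \<kappa> N u) =
    (\<lambda>u. \<Sum>m\<le>l. \<Sum>n\<le>N. E_coef n m / fact m * (phi (l - m) (\<kappa> - int n) (u - 1) -
      (\<Sum>i\<le>N - n. (-1) ^ i / fact i * phi (l - m) (\<kappa> - int n - int i) u)))"
    unfolding expansion_shift_eq expansion_def by (simp add: sum_subtractf right_diff_distrib)
  also have "\<dots> \<in> O(\<lambda>u. ln u ^ l * u powi (\<kappa> - int N - 1))"
  proof (intro big_sum_in_bigo)
    fix m n assume mn: "m \<in> {..l}" "n \<in> {..N}"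
    have "(\<lambda>u. phi (l - m) (\<kappa> - int n) (u - 1) -
      (\<Sum>i\<le>N - n. (-1) ^ i / fact i * phi (l - m) (\<kappa> - int n - int i) u))
      \<in> O(\<lambda>u. ln u ^ (l - m) * u powi (\<kappa> - int n - int (N - n) - 1))"
      by (rule phi_shift)
    also have "\<kappa> - int n - int (N - n) - 1 = \<kappa> - int N - 1" using mn by auto
    also have "(\<lambda>u::real. ln u ^ (l - m) * u powi (\<kappa> - int N - 1)) \<in> O(\<lambda>u. ln u ^ l * u powi (\<kappa> - int N - 1))"
      by (rule ln_powi_bigo) simp
    finally show "(\<lambda>u. E_coef n m / fact m * (phi (l - m) (\<kappa> - int n) (u - 1) -
      (\<Sum>i\<le>N - n. (-1) ^ i / fact i * phi (l - m) (\<kappa> - int n - int i) u)))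
      \<in> O(\<lambda>u. ln u ^ l * u powi (\<kappa> - int N - 1))"
      by (rule bigo_cmult)
  qed
  finally show ?thesis .
qed

section \<open>Laplace transforms near zero\<close>

lemma logpoly_fps: "logpoly b k x = fps_nth (Abs_fps b * fps_exp x) k"
  by (simp add: logpoly_def fps_mult_nth atLeast0AtMost)

lemma logpoly_add: "logpoly b k (x + y) = (\<Sum>j\<le>k. x ^ j / fact j * logpoly b (k - j) y)"
proof -
  have "Abs_fps b * fps_exp (x + y) = fps_exp x * (Abs_fps b * fps_exp y)"
    by (simp add: fps_exp_add_mult mult_ac)
  then have "logpoly b k (x + y) = fps_nth (fps_exp x * (Abs_fps b * fps_exp y)) k"
    by (simp only: logpoly_fps)
  then show ?thesis by (simp add: logpoly_fps fps_mult_nth[of "fps_exp x"] atLeast0AtMost)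
qed

text \<open>The Taylor series of \<Gamma>(1+z).\<close>

definition ln_moment_fps :: "real fps" where
  "ln_moment_fps = Abs_fps (\<lambda>k. ln_moment k / fact k)"

lemma logpoly_integral:
  "has_bochner_integral lborel (\<lambda>t. indicator {0<..} t * (exp (- t) * logpoly b k (ln t)))
     (fps_nth (Abs_fps b * ln_moment_fps) k)"
proof -
  have "has_bochner_integral lborel
      (\<lambda>t. \<Sum>r\<le>k. b r / fact (k - r) * (indicator {0<..} t * (exp (- t) * ln t ^ (k - r))))
      (\<Sum>r\<le>k. b r / fact (k - r) * ln_moment (k - r))"
    by (intro has_bochner_integral_sum has_bochner_integral_mult_right)
       (simp add: has_bochner_integral_iff exp_ln_power_integrable ln_moment_def)
  also have "(\<lambda>t::real. \<Sum>r\<le>k. b r / fact (k - r) * (indicator {0<..} t * (exp (- t) * ln t ^ (k - r))))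
      = (\<lambda>t. indicator {0<..} t * (exp (- t) * logpoly b k (ln t)))"
    by (auto simp: logpoly_def sum_distrib_left intro!: sum.cong)
  also have "(\<Sum>r\<le>k. b r / fact (k - r) * ln_moment (k - r)) = fps_nth (Abs_fps b * ln_moment_fps) k"
    by (simp add: fps_mult_nth ln_moment_fps_def atLeast0AtMost)
  finally show ?thesis .
qed

text \<open>Substitute u = x/s. Then ln u = ln x - ln s contributes exp(-z ln s), and integrating
  x^z exp(-x) contributes \<Gamma>(1+z).\<close>

lemma logpoly_laplace:
  assumes s: "s > 0"
  shows "integrable lborel (\<lambda>u. indicator {0<..} u * (exp (- s * u) * logpoly b k (ln u)))" (is ?int)
    and "s * (\<integral>u. indicator {0<..} u * (exp (- s * u) * logpoly b k (ln u)) \<partial>lborel)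
           = fps_nth (fps_exp (- ln s) * (Abs_fps b * ln_moment_fps)) k" (is ?eq)
proof -
  let ?f = "\<lambda>u. indicator {0<..} u * (exp (- s * u) * logpoly b k (ln u))"
  have scaled: "?f (0 + (1 / s) * x) =
      (\<Sum>j\<le>k. (- ln s) ^ j / fact j * (indicator {0<..} x * (exp (- x) * logpoly b (k - j) (ln x))))" for x
  proof (cases "x > 0")
    case True
    then have "ln (x / s) = - ln s + ln x" using s by (simp add: ln_div)
    then have "logpoly b k (ln (x / s)) = (\<Sum>j\<le>k. (- ln s) ^ j / fact j * logpoly b (k - j) (ln x))"
      by (simp only: logpoly_add)
    then show ?thesis using True s by (simp add: sum_distrib_left mult_ac)
  next
    case False
    then show ?thesis using s by (simp add: zero_less_divide_iff)
  qed
  have "has_bochner_integral lborel (\<lambda>x. ?f (0 + (1 / s) * x))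
      (\<Sum>j\<le>k. (- ln s) ^ j / fact j * fps_nth (Abs_fps b * ln_moment_fps) (k - j))"
    unfolding scaled by (intro has_bochner_integral_sum has_bochner_integral_mult_right logpoly_integral)
  then have *: "has_bochner_integral lborel (\<lambda>x. ?f (0 + (1 / s) * x))
      (fps_nth (fps_exp (- ln s) * (Abs_fps b * ln_moment_fps)) k)"
    by (simp add: fps_mult_nth[of "fps_exp _"] atLeast0AtMost)
  then show ?int
    using lborel_integrable_real_affine_iff[of "1 / s" ?f 0] s by (simp add: has_bochner_integral_iff)
  show ?eq
    using lborel_integral_real_affine[of "1 / s" ?f 0] s * by (simp add: has_bochner_integral_iff)
qed

text \<open>The denominator \<Gamma>(1+z) carried by \<open>phi_coef 0\<close> cancels the
  \<Gamma>(1+z) created by integration.\<close>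

lemma phi_coef_0_ln_moment: "Abs_fps (phi_coef 0) * ln_moment_fps = fps_exp (- euler_mascheroni)"
proof (rule fps_ext)
  fix k
  have "fps_nth (Abs_fps (phi_coef 0) * ln_moment_fps) k
      = (\<Sum>r\<le>k. (-1) ^ r * C_coef r 0 * ln_moment (k - r) / fact (k - r))"
    by (simp add: fps_mult_nth ln_moment_fps_def phi_coef_def atLeast0AtMost)
  then show "fps_nth (Abs_fps (phi_coef 0) * ln_moment_fps) k = fps_nth (fps_exp (- euler_mascheroni)) k"
    by (simp add: C_coef_ln_moment)
qed

lemma phi_laplace:
  assumes "s > 0"
  shows "integrable lborel (\<lambda>u. indicator {0<..} u * (exp (- s * u) * phi k 0 u))"
    and "s * (\<integral>u. indicator {0<..} u * (exp (- s * u) * phi k 0 u) \<partial>lborel)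
           = (- euler_mascheroni - ln s) ^ k / fact k"
proof -
  have "phi k 0 = (\<lambda>u. logpoly (phi_coef 0) k (ln u))" by (simp add: phi_def fun_eq_iff)
  moreover have "fps_exp (- ln s) * fps_exp (- euler_mascheroni) = fps_exp (- euler_mascheroni - ln s)"
    by (subst fps_exp_add_mult[symmetric]) simp
  ultimately show "integrable lborel (\<lambda>u. indicator {0<..} u * (exp (- s * u) * phi k 0 u))"
    "s * (\<integral>u. indicator {0<..} u * (exp (- s * u) * phi k 0 u) \<partial>lborel)
           = (- euler_mascheroni - ln s) ^ k / fact k"
    using logpoly_laplace[OF assms, of "phi_coef 0" k] unfolding phi_coef_0_ln_moment by simp_all
qed

lemma ln_laplace:
  assumes s: "s > (0::real)"
  shows "integrable lborel (\<lambda>u. indicator {0<..} u * (exp (- s * u) * ln u))"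
    and "s * (\<integral>u. indicator {0<..} u * (exp (- s * u) * ln u) \<partial>lborel) = - euler_mascheroni - ln s"
proof -
  let ?b = "\<lambda>r::nat. if r = 0 then 1 else (0::real)"
  have 1: "logpoly ?b 1 x = x" for x by (simp add: logpoly_def)
  have "Abs_fps ?b = 1" by (rule fps_ext) simp
  moreover have "ln_moment 0 = 1" using Gamma_fps_0 by (simp add: Gamma_fps_def)
  ultimately have 2: "fps_nth (fps_exp (- ln s) * (Abs_fps ?b * ln_moment_fps)) 1 = - euler_mascheroni - ln s"
    using ln_moment_1 by (simp add: fps_mult_nth ln_moment_fps_def)
  show "integrable lborel (\<lambda>u. indicator {0<..} u * (exp (- s * u) * ln u))"
    "s * (\<integral>u. indicator {0<..} u * (exp (- s * u) * ln u) \<partial>lborel) = - euler_mascheroni - ln s"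
    using logpoly_laplace[OF s, of ?b 1] unfolding 1 2 by auto
qed

lemma exp_integral:
  assumes "s > (0::real)"
  shows "has_bochner_integral lborel (\<lambda>u. indicator {0<..} u * exp (- s * u)) (1 / s)"
proof -
  let ?b = "\<lambda>r::nat. if r = 0 then 1 else (0::real)"
  have 1: "logpoly ?b 0 x = 1" for x by (simp add: logpoly_def)
  have "Abs_fps ?b = 1" by (rule fps_ext) simp
  moreover have "ln_moment 0 = 1" using Gamma_fps_0 by (simp add: Gamma_fps_def)
  ultimately have 2: "fps_nth (fps_exp (- ln s) * (Abs_fps ?b * ln_moment_fps)) 0 = 1"
    by (simp add: ln_moment_fps_def)
  show ?thesis
    using logpoly_laplace[OF assms, of ?b 0] assms unfolding 1 2
    by (simp add: has_bochner_integral_iff field_simps)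
qed

section \<open>The transform of K and the behaviour of E_1 at zero\<close>

lemma exp_nn_integral:
  assumes "s > (0::real)"
  shows "(\<integral>\<^sup>+u. ennreal (exp (- s * u)) * simplex_int 0 0 u \<partial>lborel) = ennreal (1 / s)"
proof -
  have "(\<integral>\<^sup>+u. ennreal (exp (- s * u)) * simplex_int 0 0 u \<partial>lborel) =
      (\<integral>\<^sup>+u. ennreal (indicator {0<..} u * exp (- s * u)) \<partial>lborel)"
  proof (rule nn_integral_cong_AE)
    show "AE u in lborel. ennreal (exp (- s * u)) * simplex_int 0 0 u = ennreal (indicator {0<..} u * exp (- s * u))"
      using AE_lborel_singleton[of "0::real"] by eventually_elim (auto simp: indicator_def)
  qed
  also have "\<dots> = ennreal (1 / s)"
    using exp_integral[OF assms] by (subst nn_integral_eq_integral) (auto simp: has_bochner_integral_iff)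
  finally show ?thesis .
qed

lemma exp_int_finite: "s > 0 \<Longrightarrow> exp_int s < \<infinity>"
proof -
  assume s: "s > 0"
  have "exp_int s \<le> (\<integral>\<^sup>+u. ennreal (exp (- s * u)) * simplex_int 0 0 u \<partial>lborel)"
    unfolding exp_int_def
  proof (rule nn_integral_mono)
    fix t :: real
    show "ennreal (indicator {1..} t / t * exp (- s * t)) \<le> ennreal (exp (- s * t)) * simplex_int 0 0 t"
      by (cases "t \<ge> 1") (auto simp: indicator_def intro!: ennreal_leI divide_le_eq_1[THEN iffD2] simp: field_simps)
  qed
  then show ?thesis unfolding exp_nn_integral[OF s] by (auto intro: le_less_trans)
qed

lemma simplex_int_finite: "simplex_int l \<kappa> u < \<infinity>"
  using simplex_int_bound[of l \<kappa> u] by (rule le_less_trans) simp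

lemma simplex_int_real_laplace:
  assumes s: "s > 0"
  shows "has_bochner_integral lborel (\<lambda>u. indicator {0<..} u * (exp (- s * u) * enn2real (simplex_int l 0 u)))
     (enn2real (exp_int s) ^ l / s)"
proof (rule has_bochner_integral_nn_integral)
  have "(\<integral>\<^sup>+u. ennreal (indicator {0<..} u * (exp (- s * u) * enn2real (simplex_int l 0 u))) \<partial>lborel)
      = (\<integral>\<^sup>+u. ennreal (exp (- s * u)) * simplex_int l 0 u \<partial>lborel)"
  proof (rule nn_integral_cong_AE)
    show "AE u in lborel. ennreal (indicator {0<..} u * (exp (- s * u) * enn2real (simplex_int l 0 u))) = ennreal (exp (- s * u)) * simplex_int l 0 u"
      using AE_lborel_singleton[of "0::real"]
      by eventually_elim (use simplex_int_finite in \<open>auto simp: indicator_def ennreal_mult simplex_int_neg\<close>)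
  qed
  also have "\<dots> = exp_int s ^ l * ennreal (1 / s)"
    by (subst simplex_int_laplace) (simp only: exp_nn_integral[OF s])
  also have "exp_int s = ennreal (enn2real (exp_int s))" using exp_int_finite[OF s] by simp
  also have "\<dots> ^ l * ennreal (1 / s) = ennreal (enn2real (exp_int s) ^ l / s)"
    using s by (simp add: ennreal_power ennreal_mult''[symmetric])
  finally show "(\<integral>\<^sup>+u. ennreal (indicator {0<..} u * (exp (- s * u) * enn2real (simplex_int l 0 u))) \<partial>lborel)
     = ennreal (enn2real (exp_int s) ^ l / s)" .
qed (use s in auto)

lemma simplex_int_1_0: "enn2real (simplex_int 1 0 u) = indicator {1..} u * ln u"
proof (cases "u \<ge> 1")
  case True
  have "simplex_int 1 0 u = (\<integral>\<^sup>+t. ennreal (1 / t) * indicator {1..u} t \<partial>lborel)"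
    unfolding One_nat_def simplex_int.simps by (intro nn_integral_cong) (auto simp: indicator_def)
  also have "\<dots> = ennreal (ln u - ln 1)"
    by (rule nn_integral_FTC_Icc) (use True in \<open>auto intro!: derivative_eq_intros\<close>)
  finally show ?thesis using True by simp
next
  case False
  have "ennreal (indicator {1..} t / t) * simplex_int 0 0 (u - t) = 0" for t
    using False by (auto simp: indicator_def)
  then have "simplex_int 1 0 u = 0" unfolding One_nat_def simplex_int.simps(2) by (simp del: mult_eq_0_iff simplex_int.simps)
  then show ?thesis using False by simp
qed

text \<open>E_1(s)/s is the transform of ln u restricted to u \<ge> 1, and (-\<gamma> - ln s)/s that
  of ln u on the whole half-line. They differ only by an integral over (0, 1), so A can be the
  integral of |ln u| there.\<close>

lemma exp_int_expansion:
  obtains A where "A \<ge> 0" "\<And>s. s > 0 \<Longrightarrow> \<bar>enn2real (exp_int s) - (- euler_mascheroni - ln s)\<bar> \<le> A * s"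
proof
  let ?g = "\<lambda>u::real. indicator {0<..<1} u * \<bar>ln u\<bar>"
  have g: "integrable lborel ?g"
  proof (rule Bochner_Integration.integrable_bound)
    show "integrable lborel (\<lambda>u::real. exp 1 * (indicator {0<..} u * (exp (- 1 * u) * ln u)))"
      by (intro integrable_mult_right ln_laplace) simp
    show "AE u::real in lborel. norm (?g u) \<le> norm (exp 1 * (indicator {0<..} u * (exp (- 1 * u) * ln u)))"
    proof (rule AE_I2)
      fix u :: real
      have "1 * \<bar>ln u\<bar> \<le> (exp 1 * exp (- u)) * \<bar>ln u\<bar>" if "u < 1"
        using that by (intro mult_right_mono) (auto simp: exp_add[symmetric])
      then show "norm (?g u) \<le> norm (exp 1 * (indicator {0<..} u * (exp (- 1 * u) * ln u)))"
        by (auto simp: indicator_def abs_mult)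
    qed
  qed simp
  show "(\<integral>u. ?g u \<partial>lborel) \<ge> 0" by (intro integral_nonneg_AE) auto
  fix s :: real assume s: "s > 0"
  define a where "a = (\<lambda>u. indicator {0<..} u * (exp (- s * u) * enn2real (simplex_int 1 0 u)))"
  define b where "b = (\<lambda>u. indicator {0<..} u * (exp (- s * u) * ln u))"
  have a: "integrable lborel a" "s * integral\<^sup>L lborel a = enn2real (exp_int s)"
    using simplex_int_real_laplace[OF s, of 1] s by (auto simp: has_bochner_integral_iff a_def)
  have b: "integrable lborel b" "s * integral\<^sup>L lborel b = - euler_mascheroni - ln s"
    unfolding b_def by (fact ln_laplace[OF s])+
  have le: "\<bar>a u - b u\<bar> \<le> ?g u" for u
  proof (cases "0 < u \<and> u < 1")
    case True
    then have "exp (- s * u) * \<bar>ln u\<bar> \<le> 1 * \<bar>ln u\<bar>" using s by (intro mult_right_mono) auto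
    then show ?thesis using True by (simp add: simplex_int_1_0 abs_mult a_def b_def del: One_nat_def)
  next
    case False
    then show ?thesis by (auto simp: simplex_int_1_0 indicator_def a_def b_def simp del: One_nat_def)
  qed
  have "enn2real (exp_int s) - (- euler_mascheroni - ln s) = s * (\<integral>u. a u - b u \<partial>lborel)"
    using a b by (simp add: right_diff_distrib)
  also have "\<bar>\<dots>\<bar> = s * \<bar>\<integral>u. a u - b u \<partial>lborel\<bar>" using s by (simp add: abs_mult)
  also have "\<bar>\<integral>u. a u - b u \<partial>lborel\<bar> \<le> (\<integral>u. \<bar>a u - b u\<bar> \<partial>lborel)"
    by (rule integral_abs_bound)
  also have "\<dots> \<le> (\<integral>u. ?g u \<partial>lborel)"
    using a b by (intro integral_mono le g) auto
  finally show "\<bar>enn2real (exp_int s) - (- euler_mascheroni - ln s)\<bar> \<le> (\<integral>u. ?g u \<partial>lborel) * s"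
    using s by (simp add: mult.commute)
qed

text \<open>Here y may be unbounded, so x - y \<rightarrow> 0 alone would not pass to powers. The
  weight y^j strengthens the claim enough for induction, by x^(l+1) - y^(l+1) = (x^l - y^l) y + (x -
  y)(x^l - y^l) + (x - y) y^l.\<close>

lemma power_diff_tendsto_0:
  fixes x y :: "'a \<Rightarrow> real"
  assumes "\<And>n. ((\<lambda>s. (x s - y s) * y s ^ n) \<longlongrightarrow> 0) F"
  shows "((\<lambda>s. (x s ^ l - y s ^ l) * y s ^ j) \<longlongrightarrow> 0) F"
proof (induction l arbitrary: j)
  case (Suc l)
  have "((\<lambda>s. (x s ^ l - y s ^ l) * y s ^ Suc j + ((x s - y s) * y s ^ 0 * ((x s ^ l - y s ^ l) * y s ^ j)
       + (x s - y s) * y s ^ (l + j))) \<longlongrightarrow> 0 + (0 * 0 + 0)) F"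
    by (intro tendsto_intros Suc assms)
  then show ?case by (simp add: algebra_simps power_add)
qed simp

lemma exp_int_power_tendsto:
  "((\<lambda>s. enn2real (exp_int s) ^ l - (- euler_mascheroni - ln s) ^ l) \<longlongrightarrow> 0) (at_right 0)"
proof -
  obtain A where A: "A \<ge> 0" "\<And>s. s > 0 \<Longrightarrow> \<bar>enn2real (exp_int s) - (- euler_mascheroni - ln s)\<bar> \<le> A * s"
    using exp_int_expansion by blast
  have "((\<lambda>s. (enn2real (exp_int s) - (- euler_mascheroni - ln s)) * (- euler_mascheroni - ln s) ^ n) \<longlongrightarrow> 0) (at_right 0)" for n
  proof (rule Lim_null_comparison)
    show "eventually (\<lambda>s. norm ((enn2real (exp_int s) - (- euler_mascheroni - ln s)) * (- euler_mascheroni - ln s) ^ n)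
        \<le> A * (s * \<bar>- euler_mascheroni - ln s\<bar> ^ n)) (at_right 0)"
      using eventually_at_right_less[of "0::real"]
      by eventually_elim (use A in \<open>auto simp: abs_mult power_abs mult.assoc[symmetric] intro!: mult_right_mono\<close>)
    have "((\<lambda>s::real. s * \<bar>- g - ln s\<bar> ^ n) \<longlongrightarrow> 0) (at_right 0)" for g :: real
    proof (rule Lim_transform_eventually)
      have "filterlim (\<lambda>s. - g + - ln s) at_top (at_right 0)"
        by (intro filterlim_tendsto_add_at_top[OF tendsto_const]
            filterlim_compose[OF filterlim_uminus_at_top_at_bot ln_at_0])
      from filterlim_compose[OF tendsto_power_div_exp_0 this]
      have "((\<lambda>s. \<bar>(- g + - ln s) ^ n / exp (- g + - ln s)\<bar>) \<longlongrightarrow> 0) (at_right 0)"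
        by (rule tendsto_rabs_zero)
      from tendsto_mult_right_zero[OF this, of "exp (- g)"]
      show "((\<lambda>s. exp (- g) * \<bar>(- g + - ln s) ^ n / exp (- g + - ln s)\<bar>) \<longlongrightarrow> 0) (at_right 0)" .
      show "eventually (\<lambda>s. exp (- g) * \<bar>(- g + - ln s) ^ n / exp (- g + - ln s)\<bar> = s * \<bar>- g - ln s\<bar> ^ n) (at_right 0)"
        using eventually_at_right_less[of "0::real"]
        by eventually_elim (simp add: exp_diff exp_minus power_abs abs_mult field_simps)
    qed
    from tendsto_mult_right_zero[OF this]
    show "((\<lambda>s. A * (s * \<bar>- euler_mascheroni - ln s\<bar> ^ n)) \<longlongrightarrow> 0) (at_right 0)" .
  qed
  from power_diff_tendsto_0[OF this, of l 0] show ?thesis by simp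
qed

text \<open>An Abelian theorem: s exp(-s u) has total mass 1 on the half-line, and as s
  \<rightarrow> 0 the mass on any bounded interval disappears. Cut at U, beyond which h is within
  e/2 of c; the rest contributes at most s B.\<close>

lemma laplace_tendsto:
  fixes h :: "real \<Rightarrow> real"
  assumes int: "\<And>s. s > 0 \<Longrightarrow> integrable lborel (\<lambda>u. indicator {0<..} u * (exp (- s * u) * h u))"
    and lim: "(h \<longlongrightarrow> c) at_top"
  shows "((\<lambda>s. s * (\<integral>u. indicator {0<..} u * (exp (- s * u) * h u) \<partial>lborel)) \<longlongrightarrow> c) (at_right 0)"
proof (rule tendstoI)
  fix e :: real assume "e > 0"
  define g where "g u = h u - c" for u
  have gint: "integrable lborel (\<lambda>u. indicator {0<..} u * (exp (- s * u) * g u))" if "s > 0" for s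
    using Bochner_Integration.integrable_diff[OF int[OF that] integrable_mult_right[OF integrable.intros[OF exp_integral[OF that]], of c]]
    by (simp add: g_def algebra_simps)
  have "eventually (\<lambda>u. dist (h u) c < e / 2) at_top" using lim \<open>e > 0\<close> by (intro tendstoD) auto
  then obtain U where U: "\<And>u. u \<ge> U \<Longrightarrow> \<bar>g u\<bar> < e / 2"
    by (auto simp: eventually_at_top_linorder dist_real_def g_def)
  let ?k = "\<lambda>u. indicator {0<..<U} u * \<bar>g u\<bar>"
  \<comment> \<open>Integrability at s = 1 suffices, since exp(-u) is bounded below by exp(-U) on
    (0, U).\<close>
  have k: "integrable lborel ?k"
  proof (rule Bochner_Integration.integrable_bound)
    show "integrable lborel (\<lambda>u. exp U * (indicator {0<..} u * (exp (- 1 * u) * g u)))"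
      by (intro integrable_mult_right gint) simp
    show "AE u in lborel. norm (?k u) \<le> norm (exp U * (indicator {0<..} u * (exp (- 1 * u) * g u)))"
    proof (rule AE_I2)
      fix u
      have "1 * \<bar>g u\<bar> \<le> (exp U * exp (- u)) * \<bar>g u\<bar>" if "u < U"
        using that by (intro mult_right_mono) (auto simp: exp_add[symmetric])
      then show "norm (?k u) \<le> norm (exp U * (indicator {0<..} u * (exp (- 1 * u) * g u)))"
        by (auto simp: indicator_def abs_mult)
    qed
    \<comment> \<open>Measurability of h is not among the assumptions; it is recovered on the
      interval from the integrand at s = 1 by multiplying with exp(u).\<close>
    have "(\<lambda>u. indicator {0<..<U} u * \<bar>exp u * (indicator {0<..} u * (exp (- 1 * u) * g u))\<bar>) \<in> borel_measurable lborel"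
      using borel_measurable_integrable[OF gint[of 1]] by measurable
    also have "(\<lambda>u. indicator {0<..<U} u * \<bar>exp u * (indicator {0<..} u * (exp (- 1 * u) * g u))\<bar>) = ?k"
      by (auto simp: fun_eq_iff indicator_def abs_mult exp_minus)
    finally show "?k \<in> borel_measurable lborel" .
  qed
  define B where "B = (\<integral>u. ?k u \<partial>lborel)"
  have "B \<ge> 0" unfolding B_def by (intro integral_nonneg_AE) auto
  have bound: "\<bar>s * (\<integral>u. indicator {0<..} u * (exp (- s * u) * h u) \<partial>lborel) - c\<bar> \<le> s * B + e / 2" if s: "s > 0" for s
  proof -
    note ei = exp_integral[OF s, unfolded has_bochner_integral_iff]
    have "(\<integral>u. indicator {0<..} u * (exp (- s * u) * g u) \<partial>lborel)
        = (\<integral>u. indicator {0<..} u * (exp (- s * u) * h u) - c * (indicator {0<..} u * exp (- s * u)) \<partial>lborel)"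
      by (intro Bochner_Integration.integral_cong) (auto simp: g_def algebra_simps)
    also have "\<dots> = (\<integral>u. indicator {0<..} u * (exp (- s * u) * h u) \<partial>lborel) - c * (1 / s)"
      using ei int[OF s] by (subst Bochner_Integration.integral_diff) auto
    finally have "s * (\<integral>u. indicator {0<..} u * (exp (- s * u) * h u) \<partial>lborel) - c =
        s * (\<integral>u. indicator {0<..} u * (exp (- s * u) * g u) \<partial>lborel)"
      using s by (simp add: right_diff_distrib)
    also have "\<bar>\<dots>\<bar> = s * \<bar>\<integral>u. indicator {0<..} u * (exp (- s * u) * g u) \<partial>lborel\<bar>"
      using s by (simp add: abs_mult)
    also have "\<dots> \<le> s * (\<integral>u. ?k u + e / 2 * (indicator {0<..} u * exp (- s * u)) \<partial>lborel)"
    proof (intro mult_left_mono order.trans[OF integral_abs_bound] integral_mono)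
      show "integrable lborel (\<lambda>u. \<bar>indicator {0<..} u * (exp (- s * u) * g u)\<bar>)"
        by (intro integrable_abs gint s)
      show "integrable lborel (\<lambda>u. ?k u + e / 2 * (indicator {0<..} u * exp (- s * u)))"
        using k ei by (intro Bochner_Integration.integrable_add integrable_mult_right) auto
      fix u :: real
      have "exp (- s * u) * \<bar>g u\<bar> \<le> 1 * \<bar>g u\<bar>" if "u > 0"
        using that s by (intro mult_right_mono) auto
      moreover have "exp (- s * u) * \<bar>g u\<bar> \<le> exp (- s * u) * (e / 2)" if "u \<ge> U"
        using U[OF that] by (intro mult_left_mono) auto
      ultimately show "\<bar>indicator {0<..} u * (exp (- s * u) * g u)\<bar> \<le> ?k u + e / 2 * (indicator {0<..} u * exp (- s * u))"
        using \<open>e > 0\<close> by (cases "u > 0"; cases "u \<ge> U") (auto simp: abs_mult indicator_def mult_ac add_increasing2)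
    qed (use s in auto)
    also have "(\<integral>u. ?k u + e / 2 * (indicator {0<..} u * exp (- s * u)) \<partial>lborel) = B + e / 2 * (1 / s)"
      using k ei by (subst Bochner_Integration.integral_add) (auto simp: B_def)
    finally show ?thesis using s by (simp add: distrib_left)
  qed
  have "((\<lambda>s. s * B + e / 2) \<longlongrightarrow> 0 * B + e / 2) (at_right 0)" by (intro tendsto_intros)
  from order_tendstoD(2)[OF this, of e] have "eventually (\<lambda>s. s * B + e / 2 < e) (at_right 0)"
    using \<open>e > 0\<close> by simp
  with eventually_at_right_less[of "0::real"]
  show "eventually (\<lambda>s. dist (s * (\<integral>u. indicator {0<..} u * (exp (- s * u) * h u) \<partial>lborel)) c < e) (at_right 0)"
    by eventually_elim (use bound in \<open>force simp: dist_real_def\<close>)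
qed

lemma simplex_int_phi_limit:
  assumes "((\<lambda>u. enn2real (simplex_int l 0 u) / fact l - phi l 0 u) \<longlongrightarrow> c) at_top"
  shows "c = 0"
proof -
  let ?h = "\<lambda>u. enn2real (simplex_int l 0 u) / fact l - phi l 0 u"
  have eq: "indicator {0<..} u * (exp (- s * u) * ?h u) =
      1 / fact l * (indicator {0<..} u * (exp (- s * u) * enn2real (simplex_int l 0 u)))
      - indicator {0<..} u * (exp (- s * u) * phi l 0 u)" for s u
    by (simp add: algebra_simps)
  have int: "integrable lborel (\<lambda>u. indicator {0<..} u * (exp (- s * u) * ?h u))" if "s > 0" for s
    unfolding eq using simplex_int_real_laplace[OF that, of l] phi_laplace[OF that, of l]
    by (intro Bochner_Integration.integrable_diff integrable_mult_right) (auto simp: has_bochner_integral_iff)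
  have val: "s * (\<integral>u. indicator {0<..} u * (exp (- s * u) * ?h u) \<partial>lborel) =
      (enn2real (exp_int s) ^ l - (- euler_mascheroni - ln s) ^ l) / fact l" if "s > 0" for s
  proof -
    have "(\<integral>u. indicator {0<..} u * (exp (- s * u) * ?h u) \<partial>lborel) =
       1 / fact l * (enn2real (exp_int s) ^ l / s) - (\<integral>u. indicator {0<..} u * (exp (- s * u) * phi l 0 u) \<partial>lborel)"
      unfolding eq using simplex_int_real_laplace[OF that, of l] phi_laplace[OF that, of l]
      by (subst Bochner_Integration.integral_diff) (auto simp: has_bochner_integral_iff)
    then show ?thesis using phi_laplace(2)[OF that, of l] that
      by (simp add: right_diff_distrib diff_divide_distrib)
  qed
  have "((\<lambda>s. s * (\<integral>u. indicator {0<..} u * (exp (- s * u) * ?h u) \<partial>lborel)) \<longlongrightarrow> c) (at_right 0)"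
    by (rule laplace_tendsto[OF int assms])
  moreover have "((\<lambda>s. s * (\<integral>u. indicator {0<..} u * (exp (- s * u) * ?h u) \<partial>lborel)) \<longlongrightarrow> 0) (at_right 0)"
  proof (rule Lim_transform_eventually[where f = "\<lambda>s. (enn2real (exp_int s) ^ l - (- euler_mascheroni - ln s) ^ l) / fact l"])
    show "((\<lambda>s. (enn2real (exp_int s) ^ l - (- euler_mascheroni - ln s) ^ l) / fact l) \<longlongrightarrow> 0) (at_right 0)"
      using tendsto_divide[OF exp_int_power_tendsto[of l] tendsto_const[of "fact l"]] by simp
    show "eventually (\<lambda>s. (enn2real (exp_int s) ^ l - (- euler_mascheroni - ln s) ^ l) / fact l =
        s * (\<integral>u. indicator {0<..} u * (exp (- s * u) * ?h u) \<partial>lborel)) (at_right 0)"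
      by (rule eventually_mono[OF eventually_at_right_less]) (rule val[symmetric])
  qed
  ultimately show ?thesis by (rule tendsto_unique[OF trivial_limit_at_right_real])
qed

section \<open>The expansion\<close>

lemma simplex_int_eq_ennreal: "simplex_int l \<kappa> u = ennreal (fact l * K_fun l u \<kappa>)"
  using simplex_int_finite[of l \<kappa> u] by (simp add: K_fun_eq)

lemma K_fun_nonneg: "K_fun l u \<kappa> \<ge> 0"
  by (simp add: K_fun_eq)

lemma K_fun_0: "u \<ge> 0 \<Longrightarrow> K_fun 0 u \<kappa> = u ^ \<kappa>"
  by (simp add: K_fun_eq)

lemma K_fun_bound:
  assumes "u \<ge> 0" shows "K_fun l u \<kappa> \<le> u ^ (\<kappa> + l)"
proof -
  have "ennreal (fact l * K_fun l u \<kappa>) \<le> ennreal (u ^ (\<kappa> + l))"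
    using simplex_int_bound[of l \<kappa> u] assms by (simp add: simplex_int_eq_ennreal max_def)
  then have "fact l * K_fun l u \<kappa> \<le> u ^ (\<kappa> + l)"
    using assms by (subst (asm) ennreal_le_iff) auto
  moreover have "1 * K_fun l u \<kappa> \<le> fact l * K_fun l u \<kappa>"
    by (intro mult_right_mono K_fun_nonneg) (simp add: fact_ge_1)
  ultimately show ?thesis by simp
qed

lemma simplex_prim_eq_K_fun: "simplex_prim l \<kappa> u = ennreal (fact l * K_fun l u (Suc \<kappa>) / real (Suc \<kappa>))"
proof -
  have "ennreal (real (Suc \<kappa>)) * ennreal (fact l * K_fun l u (Suc \<kappa>) / real (Suc \<kappa>)) = simplex_int l (Suc \<kappa>) u"
    by (simp add: simplex_int_eq_ennreal ennreal_mult'[symmetric] del: of_nat_Suc)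
  then have "ennreal (real (Suc \<kappa>)) * ennreal (fact l * K_fun l u (Suc \<kappa>) / real (Suc \<kappa>))
      = ennreal (real (Suc \<kappa>)) * simplex_prim l \<kappa> u"
    by (simp only: simplex_prim_eq)
  then show ?thesis
    by (subst (asm) ennreal_mult_cancel_left) auto
qed

lemma K_fun_rec:
  assumes "u \<ge> 0"
  shows "u * K_fun (Suc l) u \<kappa> = K_fun (Suc l) u (Suc \<kappa>) + K_fun l (u - 1) (Suc \<kappa>) / real (Suc \<kappa>)"
proof -
  have nn: "0 \<le> fact (Suc l) * K_fun l (u - 1) (Suc \<kappa>) / real (Suc \<kappa>)"
    by (intro divide_nonneg_nonneg mult_nonneg_nonneg K_fun_nonneg) auto
  have "ennreal (u * (fact (Suc l) * K_fun (Suc l) u \<kappa>)) = ennreal u * simplex_int (Suc l) \<kappa> u"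
    using assms by (simp only: simplex_int_eq_ennreal ennreal_mult')
  also have "\<dots> = simplex_int (Suc l) (Suc \<kappa>) u + of_nat (Suc l) * simplex_prim l \<kappa> (u - 1)"
    using simplex_int_recursion[of u "Suc l" \<kappa>] by simp
  also have "of_nat (Suc l) * simplex_prim l \<kappa> (u - 1) = ennreal (fact (Suc l) * K_fun l (u - 1) (Suc \<kappa>) / real (Suc \<kappa>))"
    unfolding simplex_prim_eq_K_fun ennreal_of_nat_eq_real_of_nat
    by (subst ennreal_mult'[symmetric]) (simp_all add: mult_ac)
  also have "simplex_int (Suc l) (Suc \<kappa>) u + \<dots> =
      ennreal (fact (Suc l) * K_fun (Suc l) u (Suc \<kappa>) + fact (Suc l) * K_fun l (u - 1) (Suc \<kappa>) / real (Suc \<kappa>))"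
    unfolding simplex_int_eq_ennreal by (subst ennreal_plus[symmetric]) (use nn in \<open>auto simp: K_fun_nonneg simp del: fact_Suc\<close>)
  finally have "u * (fact (Suc l) * K_fun (Suc l) u \<kappa>) =
      fact (Suc l) * K_fun (Suc l) u (Suc \<kappa>) + fact (Suc l) * K_fun l (u - 1) (Suc \<kappa>) / real (Suc \<kappa>)"
    by (subst (asm) ennreal_inj) (use nn assms in \<open>auto simp: K_fun_nonneg simp del: fact_Suc intro!: add_nonneg_nonneg\<close>)
  then have "fact (Suc l) * (u * K_fun (Suc l) u \<kappa>) =
      fact (Suc l) * (K_fun (Suc l) u (Suc \<kappa>) + K_fun l (u - 1) (Suc \<kappa>) / real (Suc \<kappa>))"
    by (simp add: distrib_left mult_ac del: fact_Suc)
  then show ?thesis by (simp del: fact_Suc)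
qed

section \<open>Regularity of K in u\<close>

lemma K_fun_1_has_integral:
  assumes "u \<ge> 0"
  shows "((\<lambda>v. K_fun l v 0) has_integral K_fun l u 1) {0..u}"
proof -
  have [measurable]: "(\<lambda>v. K_fun l v 0) \<in> borel_measurable borel"
    unfolding K_fun_eq by measurable
  have "(\<integral>\<^sup>+v. ennreal (indicator {0..u} v * (fact l * K_fun l v 0)) \<partial>lborel) = simplex_prim l 0 u"
    unfolding simplex_prim_def
  proof (rule nn_integral_cong)
    fix v
    show "ennreal (indicator {0..u} v * (fact l * K_fun l v 0)) = indicator {..u} v * simplex_int l 0 v"
      by (cases "v < 0") (auto simp: simplex_int_eq_ennreal[symmetric] simplex_int_neg indicator_def)
  qed
  also have "\<dots> = ennreal (fact l * K_fun l u 1)" by (simp add: simplex_prim_eq_K_fun)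
  finally have "has_bochner_integral lborel (\<lambda>v. indicator {0..u} v * (fact l * K_fun l v 0)) (fact l * K_fun l u 1)"
    by (intro has_bochner_integral_nn_integral) (auto simp: K_fun_nonneg)
  from has_bochner_integral_mult_right[OF this, of "1 / fact l"]
  have "has_bochner_integral lborel (\<lambda>v. indicator {0..u} v *\<^sub>R K_fun l v 0) (K_fun l u 1)"
    by (simp add: field_simps)
  then have "set_integrable lborel {0..u} (\<lambda>v. K_fun l v 0)" "(LBINT v:{0..u}. K_fun l v 0) = K_fun l u 1"
    by (auto simp: set_integrable_def set_lebesgue_integral_def has_bochner_integral_iff)
  then show ?thesis using has_integral_set_lebesgue by (metis integrable_completion set_borel_integral_eq_integral has_integral_iff)
qed

lemma K_fun_1_isCont:
  assumes "u > 0" shows "isCont (\<lambda>u. K_fun l u 1) u"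
proof -
  have "continuous_on {0..u + 1} (\<lambda>x. integral {0..x} (\<lambda>v. K_fun l v 0))"
    by (rule indefinite_integral_continuous_1)
       (use K_fun_1_has_integral[of "u + 1" l] assms in \<open>auto simp: has_integral_iff\<close>)
  also have "?this \<longleftrightarrow> continuous_on {0..u + 1} (\<lambda>x. K_fun l x 1)"
    by (intro continuous_on_cong) (use K_fun_1_has_integral in \<open>auto simp: has_integral_iff\<close>)
  finally show ?thesis using assms by (intro continuous_on_interior) auto
qed

lemma K_fun_Suc_0_eq: "u > 0 \<Longrightarrow> K_fun (Suc l) u 0 = (K_fun (Suc l) u 1 + K_fun l (u - 1) 1) / u"
  using K_fun_rec[of u l 0] by (simp add: field_simps)

text \<open>Bootstrapping: K(u, 1) is an indefinite integral of K(u, 0) and hence continuous, and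
  the recursion expresses K(u, 0) through values of K(., 1). The bound u > 1 keeps the shifted
  argument positive.\<close>

lemma K_fun_0_isCont:
  assumes "u > 1" shows "isCont (\<lambda>u. K_fun l u 0) u"
proof -
  have ev: "eventually (\<lambda>v. v > 0) (nhds u)"
    using assms eventually_nhds_in_open[of "{0<..}" u] by auto
  show ?thesis
  proof (cases l)
    case 0
    from ev have "eventually (\<lambda>v. K_fun l v 0 = 1) (nhds u)"
      by eventually_elim (simp add: 0 K_fun_0)
    then have "isCont (\<lambda>u. K_fun l u 0) u \<longleftrightarrow> isCont (\<lambda>u. 1::real) u" by (rule isCont_cong)
    then show ?thesis by simp
  next
    case (Suc k)
    from ev have "eventually (\<lambda>v. K_fun l v 0 = (K_fun l v 1 + K_fun k (v - 1) 1) / v) (nhds u)"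
      by eventually_elim (simp add: Suc K_fun_Suc_0_eq del: One_nat_def)
    then have "isCont (\<lambda>u. K_fun l u 0) u \<longleftrightarrow> isCont (\<lambda>v. (K_fun l v 1 + K_fun k (v - 1) 1) / v) u"
      by (rule isCont_cong)
    moreover have "isCont (\<lambda>v. K_fun k (v - 1) 1) u"
      using assms by (intro isCont_o2[OF _ K_fun_1_isCont]) auto
    ultimately show ?thesis using assms K_fun_1_isCont[of u l] by (auto intro!: continuous_intros)
  qed
qed

lemma K_fun_1_deriv:
  assumes "u > 1"
  shows "((\<lambda>u. K_fun l u 1) has_real_derivative K_fun l u 0) (at u)"
proof -
  have "((\<lambda>x. integral {0..x} (\<lambda>v. K_fun l v 0)) has_vector_derivative K_fun l u 0) (at u within {0..u + 1})"
    by (rule integral_has_vector_derivative_continuous_at[where S = "{}", unfolded Diff_empty])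
       (use K_fun_1_has_integral[of "u + 1" l] assms in
         \<open>auto simp: has_integral_iff intro!: continuous_at_imp_continuous_at_within K_fun_0_isCont\<close>)
  then have "((\<lambda>x. integral {0..x} (\<lambda>v. K_fun l v 0)) has_real_derivative K_fun l u 0) (at u)"
    using assms at_within_interior[of u "{0..u + 1}"]
    by (simp add: has_real_derivative_iff_has_vector_derivative)
  moreover have "eventually (\<lambda>v. v > 0) (nhds u)"
    using assms eventually_nhds_in_open[of "{0<..}" u] by auto
  then have "eventually (\<lambda>v. integral {0..v} (\<lambda>v. K_fun l v 0) = K_fun l v 1) (nhds u)"
    by eventually_elim (use K_fun_1_has_integral in \<open>auto simp: has_integral_iff\<close>)
  ultimately show ?thesis by (subst (asm) DERIV_cong_ev[OF refl _ refl]) auto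
qed

text \<open>Differentiate the quotient form of the recursion. The bound u > 2 makes
  \<open>K_fun_1_deriv\<close> available at u - 1 as well.\<close>

lemma K_fun_0_deriv:
  assumes "u > 2"
  shows "((\<lambda>u. K_fun (Suc l) u 0) has_real_derivative K_fun l (u - 1) 0 / u) (at u)"
proof -
  have "((\<lambda>v. K_fun l (v - 1) 1) has_real_derivative K_fun l (u - 1) 0 * 1) (at u)"
    by (rule DERIV_chain2[OF K_fun_1_deriv]) (use assms in \<open>auto intro!: derivative_eq_intros\<close>)
  then have "((\<lambda>v. (K_fun (Suc l) v 1 + K_fun l (v - 1) 1) / v) has_real_derivative
     ((K_fun (Suc l) u 0 + K_fun l (u - 1) 0 * 1) * u - (K_fun (Suc l) u 1 + K_fun l (u - 1) 1) * 1) / (u * u)) (at u)"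
    using assms by (intro DERIV_divide DERIV_add K_fun_1_deriv DERIV_ident) auto
  \<comment> \<open>By the recursion the subtracted numerator equals u *
    \<open>K_fun (Suc l) u 0\<close>, so only the shifted term survives.\<close>
  also have "((K_fun (Suc l) u 0 + K_fun l (u - 1) 0 * 1) * u - (K_fun (Suc l) u 1 + K_fun l (u - 1) 1) * 1) / (u * u)
      = K_fun l (u - 1) 0 / u"
    using assms K_fun_Suc_0_eq[of u l] by (simp add: field_simps)
  finally have "((\<lambda>v. (K_fun (Suc l) v 1 + K_fun l (v - 1) 1) / v) has_real_derivative K_fun l (u - 1) 0 / u) (at u)" .
  moreover have "eventually (\<lambda>v. v > 0) (nhds u)"
    using assms eventually_nhds_in_open[of "{0<..}" u] by auto
  then have "eventually (\<lambda>v. (K_fun (Suc l) v 1 + K_fun l (v - 1) 1) / v = K_fun (Suc l) v 0) (nhds u)"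
    by eventually_elim (simp add: K_fun_Suc_0_eq del: One_nat_def)
  ultimately show ?thesis by (subst (asm) DERIV_cong_ev[OF refl _ refl]) auto
qed

section \<open>Integrating asymptotic bounds\<close>

lemma bigo_shift:
  fixes f :: "real \<Rightarrow> real"
  assumes "f \<in> O(\<lambda>u. ln u ^ l * u powi b)"
  shows "(\<lambda>u. f (u - 1)) \<in> O(\<lambda>u. ln u ^ l * u powi b)"
proof -
  have "filterlim (\<lambda>u::real. u - 1) at_top at_top"
    using filterlim_tendsto_add_at_top[OF tendsto_const[of "-1::real"] filterlim_ident] by simp
  from landau_o.big.compose[OF assms this]
  have "(\<lambda>u. f (u - 1)) \<in> O(\<lambda>u. ln (u - 1) ^ l * (u - 1) powi b)" .
  also have "(\<lambda>u::real. ln (u - 1) ^ l * (u - 1) powi b) \<in> O(\<lambda>u. ln u ^ l * u powi b)"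
  proof (rule bigoI[where c = "2 ^ nat \<bar>b\<bar>"])
    show "eventually (\<lambda>u::real. norm (ln (u - 1) ^ l * (u - 1) powi b) \<le> 2 ^ nat \<bar>b\<bar> * norm (ln u ^ l * u powi b)) at_top"
      using eventually_ge_at_top[of "2::real"]
    proof eventually_elim
      case (elim u)
      then have "ln (u - 1) ^ l * (u - 1) powi b \<le> ln u ^ l * (2 ^ nat \<bar>b\<bar> * u powi b)"
        by (intro mult_mono power_mono powi_le_half) auto
      then show ?case using elim by (simp add: abs_mult mult_ac)
    qed
  qed
  finally show ?thesis .
qed

lemma ln_power_powi_neg_tendsto_0:
  assumes "a < 0"
  shows "((\<lambda>u::real. ln u ^ k * u powi a) \<longlongrightarrow> 0) at_top"
proof (rule Lim_null_comparison)
  have "((\<lambda>u::real. ln u ^ k / exp (ln u)) \<longlongrightarrow> 0) at_top"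
    by (rule filterlim_compose[OF tendsto_power_div_exp_0 ln_at_top])
  then show "((\<lambda>u::real. \<bar>ln u ^ k / exp (ln u)\<bar>) \<longlongrightarrow> 0) at_top" by (rule tendsto_rabs_zero)
  show "eventually (\<lambda>u::real. norm (ln u ^ k * u powi a) \<le> \<bar>ln u ^ k / exp (ln u)\<bar>) at_top"
    using eventually_ge_at_top[of "1::real"]
  proof eventually_elim
    case (elim u)
    have "u powi a \<le> u powi (-1)" using assms elim by (intro power_int_increasing) auto
    then have "\<bar>ln u ^ k\<bar> * u powi a \<le> \<bar>ln u ^ k\<bar> * u powi (-1)" by (intro mult_left_mono) auto
    then show ?case using elim by (simp add: abs_mult power_int_minus field_simps)
  qed
qed

text \<open>Replaces integration of R' by monotonicity: for a nonnegative B with B' \<le> -|R'|, the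
  function R + B decreases and R - B increases, which traps a constant c within distance B of
  R.\<close>

lemma bigo_from_deriv:
  fixes R R' :: "real \<Rightarrow> real"
  assumes deriv: "eventually (\<lambda>u. (R has_real_derivative R' u) (at u)) at_top"
    and R': "R' \<in> O(\<lambda>u. ln u ^ p * u powi (- int q - 1))" and q: "q \<ge> 1"
  obtains c where "(\<lambda>u. R u - c) \<in> O(\<lambda>u. ln u ^ p * u powi (- int q))"
proof -
  obtain C where C: "C > 0" "eventually (\<lambda>u. norm (R' u) \<le> C * norm (ln u ^ p * u powi (- int q - 1))) at_top"
    using R' by (auto elim: landau_o.bigE)
  \<comment> \<open>Then ln u \<ge> 2 p, so the derivative of ln u ^ p costs at most half of what
    the derivative of u^(-q) gains; the factor 2 in B makes up for that half.\<close>
  have "eventually (\<lambda>u::real. u \<ge> exp (2 * real p)) at_top" by (rule eventually_ge_at_top)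
  with deriv C(2) have "eventually (\<lambda>u. (R has_real_derivative R' u) (at u) \<and>
      norm (R' u) \<le> C * norm (ln u ^ p * u powi (- int q - 1)) \<and> u \<ge> exp (2 * real p)) at_top"
    by eventually_elim auto
  then obtain U where U: "\<And>u. u \<ge> U \<Longrightarrow> (R has_real_derivative R' u) (at u)"
      "\<And>u. u \<ge> U \<Longrightarrow> norm (R' u) \<le> C * norm (ln u ^ p * u powi (- int q - 1))"
      "\<And>u. u \<ge> U \<Longrightarrow> u \<ge> exp (2 * real p)"
    unfolding eventually_at_top_linorder by blast
  have pos: "u > 0" if "u \<ge> U" for u
    using U(3)[OF that] less_le_trans[OF exp_gt_zero] by blast
  have ln2p: "ln u \<ge> 2 * real p" if "u \<ge> U" for u
    using U(3)[OF that] pos[OF that] by (simp add: ln_ge_iff)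
  define B where "B = (\<lambda>u::real. 2 * C * (ln u ^ p * u powi (- int q)))"
  define B' where "B' = (\<lambda>u::real. 2 * C * (real p * ln u ^ (p - 1) * (1 / u) * u powi (- int q)
       + - real q * u powi (- int q - 1) * ln u ^ p))"
  have B_deriv: "(B has_real_derivative B' u) (at u)" if "u \<ge> U" for u
  proof -
    have 1: "((\<lambda>u. ln u ^ p) has_real_derivative real p * ln u ^ (p - 1) * (1 / u)) (at u)"
      using pos[OF that] by (auto intro!: derivative_eq_intros)
    have 2: "((\<lambda>u. u powi (- int q)) has_real_derivative - real q * u powi (- int q - 1)) (at u)"
      using powi_deriv[OF pos[OF that], of "- int q"] by simp
    show ?thesis unfolding B_def B'_def by (intro DERIV_cmult DERIV_mult 1 2)
  qed
  have B_nonneg: "B u \<ge> 0" if "u \<ge> U" for u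
    using C(1) pos[OF that] ln2p[OF that] by (auto simp: B_def intro!: mult_nonneg_nonneg zero_le_power order.trans[OF _ ln2p[OF that]])
  have B'_le: "B' u \<le> - \<bar>R' u\<bar>" if "u \<ge> U" for u
  proof -
    have u: "u > 0" "ln u \<ge> 2 * real p" using pos ln2p that by auto
    then have ln0: "ln u \<ge> 0" by (meson mult_nonneg_nonneg of_nat_0_le_iff order.trans zero_le_numeral)
    define X where "X = ln u ^ p * u powi (- int q - 1)"
    have X: "X \<ge> 0" using u ln0 by (simp add: X_def)
    have "2 * (real p * ln u ^ (p - 1)) \<le> ln u ^ p"
    proof (cases p)
      case (Suc n)
      then show ?thesis using u ln0 mult_right_mono[of "2 * real p" "ln u" "ln u ^ n"]
        by (simp add: algebra_simps)
    qed simp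
    then have "2 * (real p * ln u ^ (p - 1)) * u powi (- int q - 1) \<le> X"
      unfolding X_def using u by (intro mult_right_mono) auto
    moreover have "1 / u * u powi (- int q) = u powi (- int q - 1)"
      using u by (simp add: power_int_diff)
    moreover have "2 * (real p * ln u ^ (p - 1) * (1 / u) * u powi (- int q))
        = 2 * (real p * ln u ^ (p - 1)) * (1 / u * u powi (- int q))"
      by (simp only: mult.assoc)
    ultimately have "2 * (real p * ln u ^ (p - 1) * (1 / u) * u powi (- int q)) \<le> X"
      by simp
    moreover have "1 * X \<le> real q * X" using q X by (intro mult_right_mono) auto
    ultimately have "2 * (real p * ln u ^ (p - 1) * (1 / u) * u powi (- int q) + - real q * u powi (- int q - 1) * ln u ^ p) \<le> - X"
      by (simp add: X_def mult_ac)
    then have "C * (2 * (real p * ln u ^ (p - 1) * (1 / u) * u powi (- int q) + - real q * u powi (- int q - 1) * ln u ^ p)) \<le> C * - X"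
      using C(1) by (intro mult_left_mono) auto
    then have "B' u \<le> - (C * X)" by (simp add: B'_def mult_ac)
    moreover have "\<bar>R' u\<bar> \<le> C * X" using U(2)[OF that] X by (simp add: X_def)
    ultimately show ?thesis by linarith
  qed
  have dec: "R y + B y \<le> R x + B x" and inc: "R x - B x \<le> R y - B y" if "U \<le> x" "x \<le> y" for x y
  proof -
    show "R y + B y \<le> R x + B x"
    proof (rule DERIV_nonpos_imp_nonincreasing[OF that(2)])
      fix v assume "x \<le> v" "v \<le> y"
      then have v: "v \<ge> U" using that by simp
      show "\<exists>z. ((\<lambda>v. R v + B v) has_real_derivative z) (at v) \<and> z \<le> 0"
        using B'_le[OF v] by (intro exI[of _ "R' v + B' v"] conjI DERIV_add U(1) B_deriv v) linarith
    qed
    show "R x - B x \<le> R y - B y"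
    proof (rule DERIV_nonneg_imp_nondecreasing[OF that(2)])
      fix v assume "x \<le> v" "v \<le> y"
      then have v: "v \<ge> U" using that by simp
      show "\<exists>z. ((\<lambda>v. R v - B v) has_real_derivative z) (at v) \<and> z \<ge> 0"
        using B'_le[OF v] by (intro exI[of _ "R' v - B' v"] conjI DERIV_diff U(1) B_deriv v) linarith
    qed
  qed
  \<comment> \<open>For x and y in either order; this makes every value of R - B a lower bound for R
    + B, so the infimum c lies between the two.\<close>
  have cross: "R x - B x \<le> R y + B y" if "U \<le> x" "U \<le> y" for x y
  proof (cases "x \<le> y")
    case True
    then show ?thesis using inc[OF that(1) True] B_nonneg[OF that(2)] by linarith
  next
    case False
    then have "y \<le> x" by simp
    from dec[OF that(2) this] B_nonneg[OF that(1)] show ?thesis by linarith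
  qed
  define c where "c = (INF y\<in>{U..}. R y + B y)"
  have bdd: "bdd_below ((\<lambda>y. R y + B y) ` {U..})"
    using cross[of U] by (intro bdd_belowI[of _ "R U - B U"]) auto
  have "\<bar>R x - c\<bar> \<le> B x" if "x \<ge> U" for x
  proof -
    have "c \<le> R x + B x" unfolding c_def using that bdd by (intro cINF_lower) auto
    moreover have "R x - B x \<le> c" unfolding c_def using cross[OF that] by (intro cINF_greatest) auto
    ultimately show ?thesis by linarith
  qed
  then have "(\<lambda>u. R u - c) \<in> O(\<lambda>u. ln u ^ p * u powi (- int q))"
  proof (intro bigoI[where c = "2 * C"] eventually_mono[OF eventually_ge_at_top[of U]])
    fix u assume u: "u \<ge> U"
    assume "\<And>x. x \<ge> U \<Longrightarrow> \<bar>R x - c\<bar> \<le> B x"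
    with u have "\<bar>R u - c\<bar> \<le> \<bar>B u\<bar>" by force
    then show "norm (R u - c) \<le> 2 * C * norm (ln u ^ p * u powi (- int q))"
      using C(1) by (simp add: B_def abs_mult)
  qed
  then show ?thesis by (rule that)
qed

section \<open>Induction for the expansion of K\<close>

lemma phi_neg_tendsto_0:
  assumes "a < 0" shows "(phi k a \<longlongrightarrow> 0) at_top"
proof (rule Lim_null_comparison)
  show "eventually (\<lambda>u. norm (phi k a u) \<le> (\<Sum>r\<le>k. \<bar>phi_coef a r\<bar>) * (ln u ^ k * u powi a)) at_top"
    using eventually_ge_at_top[of "exp 1 :: real"] by eventually_elim (use phi_bound in auto)
  show "((\<lambda>u. (\<Sum>r\<le>k. \<bar>phi_coef a r\<bar>) * (ln u ^ k * u powi a)) \<longlongrightarrow> 0) at_top"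
    by (intro tendsto_mult_right_zero ln_power_powi_neg_tendsto_0 assms)
qed

text \<open>For n \<ge> 1 the exponent is negative, and at n = 0 only m = 0 survives because Ein
  vanishes at 0.\<close>

lemma expansion_minus_phi_tendsto_0: "((\<lambda>u. expansion l 0 N u - phi l 0 u) \<longlongrightarrow> 0) at_top"
proof -
  have "((\<lambda>u. \<Sum>m\<le>l. \<Sum>n\<le>N. E_coef n m / fact m * phi (l - m) (0 - int n) u
       - (if m = 0 \<and> n = 0 then phi l 0 u else 0)) \<longlongrightarrow> (\<Sum>m\<le>l. \<Sum>n\<le>N. 0)) at_top"
  proof (intro tendsto_sum)
    fix m n
    show "((\<lambda>u. E_coef n m / fact m * phi (l - m) (0 - int n) u
       - (if m = 0 \<and> n = 0 then phi l 0 u else 0)) \<longlongrightarrow> 0) at_top"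
    proof (cases "n = 0")
      case True
      then show ?thesis by (cases "m = 0") (auto simp: E_coef_0 E_coef_eq_0)
    next
      case False
      then have "((\<lambda>u. E_coef n m / fact m * phi (l - m) (0 - int n) u) \<longlongrightarrow> 0) at_top"
        by (intro tendsto_mult_right_zero phi_neg_tendsto_0) simp
      then show ?thesis using False by simp
    qed
  qed
  moreover have "(\<Sum>m\<le>l. \<Sum>n\<le>N. E_coef n m / fact m * phi (l - m) (0 - int n) u
       - (if m = 0 \<and> n = 0 then phi l 0 u else 0)) = expansion l 0 N u - phi l 0 u" for u
  proof -
    have "(\<Sum>m\<le>l. \<Sum>n\<le>N. if m = 0 \<and> n = 0 then phi l 0 u else 0) =
        (\<Sum>m\<le>l. if m = 0 then \<Sum>n\<le>N. if n = 0 then phi l 0 u else 0 else 0)"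
      by (intro sum.cong) auto
    also have "\<dots> = phi l 0 u" by simp
    finally show ?thesis unfolding expansion_def sum_subtractf by simp
  qed
  ultimately show ?thesis by simp
qed

lemma expansion_0:
  assumes "u > 0" shows "fact \<kappa> * expansion 0 (int \<kappa>) N u = u ^ \<kappa>"
proof -
  have "expansion 0 (int \<kappa>) N u = (\<Sum>n\<le>N. if n = 0 then phi 0 (int \<kappa>) u else 0)"
  proof -
    have "E_coef n 0 / fact 0 * phi 0 (int \<kappa> - int n) u = (if n = 0 then phi 0 (int \<kappa>) u else 0)" for n
      by (simp add: E_coef_0)
    moreover have "expansion 0 (int \<kappa>) N u = (\<Sum>n\<le>N. E_coef n 0 / fact 0 * phi 0 (int \<kappa> - int n) u)"
      by (simp add: expansion_def)
    ultimately show ?thesis by (simp only:)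
  qed
  also have "\<dots> = phi 0 (int \<kappa>) u" by simp
  also have "\<dots> = u ^ \<kappa> / fact \<kappa>" by (simp add: phi_def logpoly_def phi_coef_def C_coef_0)
  finally show ?thesis by simp
qed

lemma K_fun_asymp_l_0:
  "(\<lambda>u. K_fun 0 u \<kappa> - fact \<kappa> * expansion 0 (int \<kappa>) N u) \<in> O(g)"
proof -
  have "eventually (\<lambda>u. K_fun 0 u \<kappa> - fact \<kappa> * expansion 0 (int \<kappa>) N u = 0) at_top"
    using eventually_gt_at_top[of 0] by eventually_elim (simp add: expansion_0 K_fun_0)
  then show ?thesis by (subst landau_o.big.in_cong[where g = "\<lambda>_. 0"]) auto
qed

lemma K_fun_minus_expansion_shift_bigo:
  assumes "(\<lambda>u. K_fun l u \<kappa> - fact \<kappa> * expansion l (int \<kappa>) N u) \<in> O(\<lambda>u. ln u ^ l * u powi (int \<kappa> - int N - 1))"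
  shows "(\<lambda>u. K_fun l (u - 1) \<kappa> - fact \<kappa> * expansion_shift l (int \<kappa>) N u) \<in> O(\<lambda>u. ln u ^ l * u powi (int \<kappa> - int N - 1))"
proof -
  have "(\<lambda>u. (K_fun l (u - 1) \<kappa> - fact \<kappa> * expansion l (int \<kappa>) N (u - 1))
      + fact \<kappa> * (expansion l (int \<kappa>) N (u - 1) - expansion_shift l (int \<kappa>) N u)) \<in> O(\<lambda>u. ln u ^ l * u powi (int \<kappa> - int N - 1))"
    by (intro sum_in_bigo bigo_shift[OF assms] bigo_cmult expansion_shift_bigo)
  then show ?thesis by (simp add: algebra_simps)
qed

lemma K_fun_asymp_kappa_0:
  "(\<lambda>u. K_fun l u 0 - expansion l 0 N u) \<in> O(\<lambda>u. ln u ^ l * u powi (- int N - 1))"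
proof (induction l arbitrary: N)
  case 0
  show ?case using K_fun_asymp_l_0[of 0 N] by simp
next
  case (Suc l)
  define R where "R = (\<lambda>u. K_fun (Suc l) u 0 - expansion (Suc l) 0 N u)"
  define R' where "R' = (\<lambda>u. K_fun l (u - 1) 0 / u - expansion (Suc l) (0 - 1) N u)"
  have "eventually (\<lambda>u. (R has_real_derivative R' u) (at u)) at_top"
    using eventually_gt_at_top[of 2]
    by eventually_elim (auto simp: R_def R'_def intro!: DERIV_diff K_fun_0_deriv expansion_deriv simp del: diff_0)
  \<comment> \<open>Division by u improves the exponent to -(N+1)-1, so
    \<open>bigo_from_deriv\<close> is used with q = N+1, which is at least 1 even for N = 0.\<close>
  moreover have "R' \<in> O(\<lambda>u. ln u ^ Suc l * u powi (- int (Suc N) - 1))"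
  proof -
    have D: "(\<lambda>u. K_fun l (u - 1) 0 - expansion_shift l 0 N u) \<in> O(\<lambda>u. ln u ^ l * u powi (- int N - 1))"
      using K_fun_minus_expansion_shift_bigo[of l 0 N] Suc[of N] by simp
    have "(\<lambda>u. u powi (-1) * (K_fun l (u - 1) 0 - expansion_shift l 0 N u)) \<in> O(\<lambda>u. u powi (-1) * (ln u ^ l * u powi (- int N - 1)))"
      by (intro landau_o.big.mult D) auto
    also have "?this \<longleftrightarrow> R' \<in> O(\<lambda>u. u powi (-1) * (ln u ^ l * u powi (- int N - 1)))"
    proof (rule landau_o.big.in_cong)
      show "eventually (\<lambda>u. u powi (-1) * (K_fun l (u - 1) 0 - expansion_shift l 0 N u) = R' u) at_top"
        using eventually_gt_at_top[of 0]
      proof eventually_elim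
        case (elim u)
        \<comment> \<open>At \<kappa> = -1 the coefficient \<kappa>+1 is zero, and u times the
          derivative of the expansion is precisely the shifted expansion of the previous
          level.\<close>
        then show ?case using expansion_rec[of u l "-1" N]
          by (simp add: R'_def power_int_minus field_simps)
      qed
    qed
    also have "O(\<lambda>u::real. u powi (-1) * (ln u ^ l * u powi (- int N - 1))) = O(\<lambda>u. ln u ^ l * u powi (- int (Suc N) - 1))"
    proof (rule landau_o.big.cong)
      show "eventually (\<lambda>u::real. u powi (-1) * (ln u ^ l * u powi (- int N - 1)) = ln u ^ l * u powi (- int (Suc N) - 1)) at_top"
        using eventually_gt_at_top[of "0::real"]
      proof eventually_elim
        case (elim u)
        have "u powi (- int (Suc N) - 1) = u powi (-1 + (- int N - 1))" by simp
        also have "\<dots> = u powi (-1) * u powi (- int N - 1)" using elim by (subst power_int_add) auto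
        finally show ?case by simp
      qed
    qed
    finally have "R' \<in> O(\<lambda>u. ln u ^ l * u powi (- int (Suc N) - 1))" .
    also have "(\<lambda>u::real. ln u ^ l * u powi (- int (Suc N) - 1)) \<in> O(\<lambda>u. ln u ^ Suc l * u powi (- int (Suc N) - 1))"
      by (rule ln_powi_bigo) simp
    finally show ?thesis .
  qed
  ultimately obtain c where c: "(\<lambda>u. R u - c) \<in> O(\<lambda>u. ln u ^ Suc l * u powi (- int (Suc N)))"
    using bigo_from_deriv[of R R' "Suc l" "Suc N"] by auto
  have "((\<lambda>u. R u - c) \<longlongrightarrow> 0) at_top"
  proof -
    obtain C where "eventually (\<lambda>u. norm (R u - c) \<le> C * norm (ln u ^ Suc l * u powi (- int (Suc N)))) at_top"
      using c by (auto elim: landau_o.bigE)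
    then show ?thesis
      by (rule Lim_null_comparison)
         (intro tendsto_mult_right_zero tendsto_norm_zero ln_power_powi_neg_tendsto_0, simp)
  qed
  \<comment> \<open>Trading the expansion for its leading term \<open>phi (Suc l) 0\<close> changes
    the difference by o(1), so c is also the limit of the quantity treated by
    \<open>simplex_int_phi_limit\<close>.\<close>
  then have "((\<lambda>u. (R u - c) + c + (expansion (Suc l) 0 N u - phi (Suc l) 0 u)) \<longlongrightarrow> 0 + c + 0) at_top"
    by (intro tendsto_intros expansion_minus_phi_tendsto_0)
  then have "((\<lambda>u. enn2real (simplex_int (Suc l) 0 u) / fact (Suc l) - phi (Suc l) 0 u) \<longlongrightarrow> c) at_top"
    by (simp add: R_def K_fun_eq[symmetric] del: simplex_int.simps fact_Suc)
  then have "c = 0" by (rule simplex_int_phi_limit)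
  moreover have "- int (Suc N) = - int N - 1" by simp
  ultimately show ?case using c unfolding R_def by (simp only: diff_zero)
qed

text \<open>Solving the recursion for \<kappa>+1 requires \<kappa> at the same l and \<kappa>+1 at l
  - 1, hence the nested inductions with l generalised in the outer one. K and the expansion satisfy
  matching recursions, so only the errors have to be tracked.\<close>

lemma K_fun_asymp:
  "(\<lambda>u. K_fun l u \<kappa> - fact \<kappa> * expansion l (int \<kappa>) N u) \<in> O(\<lambda>u. ln u ^ l * u powi (int \<kappa> - int N - 1))"
proof (induction \<kappa> arbitrary: l)
  case 0
  show ?case using K_fun_asymp_kappa_0[of l N] by simp
next
  case (Suc \<kappa>)
  note IH\<kappa> = this
  show ?case
  proof (induction l)
    case 0
    show ?case by (rule K_fun_asymp_l_0)
  next
    case (Suc l)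
    let ?g = "\<lambda>u::real. ln u ^ Suc l * u powi (int (Suc \<kappa>) - int N - 1)"
    have A: "(\<lambda>u. u * (K_fun (Suc l) u \<kappa> - fact \<kappa> * expansion (Suc l) (int \<kappa>) N u)) \<in> O(?g)"
    proof -
      have "(\<lambda>u. u * (K_fun (Suc l) u \<kappa> - fact \<kappa> * expansion (Suc l) (int \<kappa>) N u))
          \<in> O(\<lambda>u. u * (ln u ^ Suc l * u powi (int \<kappa> - int N - 1)))"
        by (intro landau_o.big.mult IH\<kappa>) auto
      also have "O(\<lambda>u::real. u * (ln u ^ Suc l * u powi (int \<kappa> - int N - 1))) = O(?g)"
      proof (rule landau_o.big.cong)
        show "eventually (\<lambda>u::real. u * (ln u ^ Suc l * u powi (int \<kappa> - int N - 1)) = ?g u) at_top"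
          using eventually_gt_at_top[of "0::real"]
        proof eventually_elim
          case (elim u)
          have exponent: "int (Suc \<kappa>) - int N - 1 = (int \<kappa> - int N - 1) + 1" by simp
          have "u powi (int (Suc \<kappa>) - int N - 1) = u powi (int \<kappa> - int N - 1) * u"
            unfolding exponent by (rule power_int_add_1) (use elim in simp)
          then show ?case by (simp only: mult_ac)
        qed
      qed
      finally show ?thesis .
    qed
    have B: "(\<lambda>u. (- 1 / real (Suc \<kappa>)) * (K_fun l (u - 1) (Suc \<kappa>) - fact (Suc \<kappa>) * expansion_shift l (int (Suc \<kappa>)) N u)) \<in> O(?g)"
    proof (rule bigo_cmult)
      have "(\<lambda>u. K_fun l (u - 1) (Suc \<kappa>) - fact (Suc \<kappa>) * expansion_shift l (int (Suc \<kappa>)) N u)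
          \<in> O(\<lambda>u. ln u ^ l * u powi (int (Suc \<kappa>) - int N - 1))"
        by (rule K_fun_minus_expansion_shift_bigo[OF Suc])
      also have "(\<lambda>u::real. ln u ^ l * u powi (int (Suc \<kappa>) - int N - 1)) \<in> O(?g)"
        by (rule ln_powi_bigo) simp
      finally show "(\<lambda>u. K_fun l (u - 1) (Suc \<kappa>) - fact (Suc \<kappa>) * expansion_shift l (int (Suc \<kappa>)) N u) \<in> O(?g)" .
    qed
    have "eventually (\<lambda>u. u * (K_fun (Suc l) u \<kappa> - fact \<kappa> * expansion (Suc l) (int \<kappa>) N u)
        + (- 1 / real (Suc \<kappa>)) * (K_fun l (u - 1) (Suc \<kappa>) - fact (Suc \<kappa>) * expansion_shift l (int (Suc \<kappa>)) N u)
        = K_fun (Suc l) u (Suc \<kappa>) - fact (Suc \<kappa>) * expansion (Suc l) (int (Suc \<kappa>)) N u) at_top"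
      using eventually_gt_at_top[of 0]
    proof eventually_elim
      case (elim u)
      have K: "u * K_fun (Suc l) u \<kappa> = K_fun (Suc l) u (Suc \<kappa>) + K_fun l (u - 1) (Suc \<kappa>) / real (Suc \<kappa>)"
        using elim by (intro K_fun_rec) auto
      have "int \<kappa> + 1 = int (Suc \<kappa>)" by simp
      with expansion_rec[OF elim, of l "int \<kappa>" N]
      have Srec: "u * expansion (Suc l) (int \<kappa>) N u = real (Suc \<kappa>) * expansion (Suc l) (int (Suc \<kappa>)) N u + expansion_shift l (int (Suc \<kappa>)) N u"
        by (simp only: of_int_of_nat_eq)
      have "u * (K_fun (Suc l) u \<kappa> - fact \<kappa> * expansion (Suc l) (int \<kappa>) N u)
          = u * K_fun (Suc l) u \<kappa> - fact \<kappa> * (u * expansion (Suc l) (int \<kappa>) N u)"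
        by (simp only: right_diff_distrib mult.left_commute)
      moreover have "fact (Suc \<kappa>) = real (Suc \<kappa>) * fact \<kappa>" by simp
      ultimately show ?case unfolding K Srec by (simp add: field_simps del: of_nat_Suc fact_Suc)
    qed
    from landau_o.big.in_cong[OF this] sum_in_bigo(1)[OF A B] show ?case by blast
  qed
qed

section \<open>Matching the stated sums and uniformity for u \<ge> l\<close>

lemma main_terms_eq_expansion:
  assumes u: "u > 0"
  shows "(\<Sum>m=0..l. \<Sum>n=m..\<kappa>. \<Sum>r=0..l-m.
           (-1)^r * fact \<kappa> * E_coef n m / (fact m * fact (l-m-r))
           * C_coef r (\<kappa>-n) * u ^ (\<kappa>-n) * ln u ^ (l-m-r))
      + (\<Sum>j=1..J. \<Sum>m=0..l. \<Sum>r=0..l-m.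
           (-1)^r * fact \<kappa> * E_coef (\<kappa>+j) m / (fact m * fact (l-m-r))
           * C_coef r 0 * (deriv ^^ j) (\<lambda>x. ln x ^ (l-m-r)) u)
      = fact \<kappa> * expansion l (int \<kappa>) (\<kappa> + J) u"
proof -
  define F where "F = (\<lambda>m n. E_coef n m / fact m * phi (l - m) (int \<kappa> - int n) u)"
  have 1: "(\<Sum>r=0..l-m. (-1)^r * fact \<kappa> * E_coef n m / (fact m * fact (l-m-r))
           * C_coef r (\<kappa>-n) * u ^ (\<kappa>-n) * ln u ^ (l-m-r)) = fact \<kappa> * F m n" if "n \<le> \<kappa>" for m n
  proof -
    have exponent: "int \<kappa> - int n = int (\<kappa> - n)" using that by simp
    have "phi (l - m) (int \<kappa> - int n) u
        = (\<Sum>r\<le>l-m. u ^ (\<kappa>-n) * ((-1)^r * C_coef r (\<kappa>-n) * ln u ^ (l-m-r) / fact (l-m-r)))"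
      unfolding exponent by (simp add: phi_def logpoly_def phi_coef_def sum_distrib_left del: of_nat_diff)
    then show ?thesis
      by (simp only: F_def sum_distrib_left atLeast0AtMost) (intro sum.cong refl, simp)
  qed
  have 2: "(\<Sum>r=0..l-m. (-1)^r * fact \<kappa> * E_coef (\<kappa>+j) m / (fact m * fact (l-m-r))
           * C_coef r 0 * (deriv ^^ j) (\<lambda>x. ln x ^ (l-m-r)) u) = fact \<kappa> * F m (\<kappa> + j)" for m j
  proof -
    have "int \<kappa> - int (\<kappa> + j) = - int j" by simp
    then have "phi (l - m) (int \<kappa> - int (\<kappa> + j)) u
        = (\<Sum>r\<le>l-m. (-1)^r * C_coef r 0 / fact (l-m-r) * (deriv ^^ j) (\<lambda>x. ln x ^ (l-m-r)) u)"
      by (simp only: phi_neg_eq_higher_deriv[OF u]) (simp add: phi_coef_def)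
    then show ?thesis
      by (simp only: F_def sum_distrib_left atLeast0AtMost) (intro sum.cong refl, simp)
  qed
  \<comment> \<open>The terms added for n < m have E_{n,m} = 0; afterwards the range of n no longer
    depends on m.\<close>
  have 3: "(\<Sum>n=m..\<kappa>. F m n) = (\<Sum>n\<le>\<kappa>. F m n)" for m
    by (rule sum.mono_neutral_left) (auto simp: F_def E_coef_eq_0)
  \<comment> \<open>With N = \<kappa> + J the cut at n = \<kappa> separates the nonnegative powers
    of u from the derivative terms n = \<kappa> + j.\<close>
  have 4: "(\<Sum>n\<le>\<kappa> + J. F m n) = (\<Sum>n\<le>\<kappa>. F m n) + (\<Sum>j=1..J. F m (\<kappa> + j))" for m
  proof -
    have "(\<Sum>n\<le>\<kappa> + J. F m n) = (\<Sum>n\<le>\<kappa>. F m n) + (\<Sum>n=Suc \<kappa>..\<kappa> + J. F m n)"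
      by (subst sum.union_disjoint[symmetric]) (auto intro!: sum.cong)
    also have "(\<Sum>n=Suc \<kappa>..\<kappa> + J. F m n) = (\<Sum>j=1..J. F m (\<kappa> + j))"
      using sum.shift_bounds_cl_nat_ivl[of "F m" 1 \<kappa> J] by (simp add: add.commute)
    finally show ?thesis .
  qed
  have "(\<Sum>m=0..l. \<Sum>n=m..\<kappa>. \<Sum>r=0..l-m. (-1)^r * fact \<kappa> * E_coef n m / (fact m * fact (l-m-r))
           * C_coef r (\<kappa>-n) * u ^ (\<kappa>-n) * ln u ^ (l-m-r)) = (\<Sum>m=0..l. \<Sum>n=m..\<kappa>. fact \<kappa> * F m n)"
    by (intro sum.cong refl 1) auto
  also have "\<dots> = fact \<kappa> * (\<Sum>m\<le>l. \<Sum>n\<le>\<kappa>. F m n)"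
    by (simp add: sum_distrib_left[symmetric] 3 atLeast0AtMost)
  finally have first: "(\<Sum>m=0..l. \<Sum>n=m..\<kappa>. \<Sum>r=0..l-m. (-1)^r * fact \<kappa> * E_coef n m / (fact m * fact (l-m-r))
           * C_coef r (\<kappa>-n) * u ^ (\<kappa>-n) * ln u ^ (l-m-r)) = fact \<kappa> * (\<Sum>m\<le>l. \<Sum>n\<le>\<kappa>. F m n)" .
  have expansion_eq: "expansion l (int \<kappa>) (\<kappa> + J) u = (\<Sum>m\<le>l. \<Sum>n\<le>\<kappa> + J. F m n)"
    by (simp only: expansion_def F_def)
  have "(\<Sum>j=1..J. \<Sum>m=0..l. fact \<kappa> * F m (\<kappa> + j)) = fact \<kappa> * (\<Sum>m\<le>l. \<Sum>j=1..J. F m (\<kappa> + j))"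
    by (subst sum.swap) (simp add: sum_distrib_left[symmetric] atLeast0AtMost)
  then show ?thesis
    unfolding first 2 expansion_eq by (simp only: 4 sum.distrib distrib_left)
qed

theorem theorem2:
  fixes \<kappa> J l :: nat
  assumes "l \<ge> 1"
  shows "\<exists>M. \<forall>u::real. u \<ge> real l \<longrightarrow>
    \<bar>K_fun l u \<kappa>
      - (\<Sum>m=0..l. \<Sum>n=m..\<kappa>. \<Sum>r=0..l-m.
           (-1)^r * fact \<kappa> * E_coef n m / (fact m * fact (l-m-r))
           * C_coef r (\<kappa>-n) * u ^ (\<kappa>-n) * ln u ^ (l-m-r))
      - (\<Sum>j=1..J. \<Sum>m=0..l. \<Sum>r=0..l-m.
           (-1)^r * fact \<kappa> * E_coef (\<kappa>+j) m / (fact m * fact (l-m-r))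
           * C_coef r 0 * (deriv ^^ j) (\<lambda>x. ln x ^ (l-m-r)) u)\<bar>
    \<le> M * ln (exp 1 * u) ^ l / u ^ (J+1)"
proof -
  define R where "R = (\<lambda>u. K_fun l u \<kappa> - fact \<kappa> * expansion l (int \<kappa>) (\<kappa> + J) u)"
  have "R \<in> O(\<lambda>u. ln u ^ l * u powi (int \<kappa> - int (\<kappa> + J) - 1))"
    unfolding R_def by (rule K_fun_asymp)
  then obtain c where c: "c > 0" "eventually (\<lambda>u. norm (R u) \<le> c * norm (ln u ^ l * u powi (int \<kappa> - int (\<kappa> + J) - 1))) at_top"
    by (rule landau_o.bigE)
  then obtain U0 where U0: "\<And>u. u \<ge> U0 \<Longrightarrow> norm (R u) \<le> c * norm (ln u ^ l * u powi (int \<kappa> - int (\<kappa> + J) - 1))"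
    by (auto simp: eventually_at_top_linorder)
  define U where "U = max U0 1"
  have ln_e: "ln (exp 1 * u) = 1 + ln u" if "u \<ge> 1" for u :: real
    using that by (simp add: ln_mult)
  have large: "\<bar>R u\<bar> \<le> c * ln (exp 1 * u) ^ l / u ^ (J + 1)" if "u \<ge> U" for u
  proof -
    have u: "u \<ge> 1" "u \<ge> U0" using that by (auto simp: U_def)
    have "int \<kappa> - int (\<kappa> + J) - 1 = - int (J + 1)" by simp
    then have "\<bar>R u\<bar> \<le> c * (ln u ^ l / u ^ (J + 1))"
      using U0[OF u(2)] u(1)
      by (simp only: power_int_minus power_int_of_nat) (simp add: abs_mult divide_inverse)
    also have "\<dots> \<le> c * (ln (exp 1 * u) ^ l / u ^ (J + 1))"
      using u c(1) by (intro mult_left_mono divide_right_mono power_mono) (auto simp: ln_e)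
    finally show ?thesis by simp
  qed
  \<comment> \<open>The asymptotic bound is silent on \<open>{1..U}\<close>. There R is bounded, and
    a constant fits under the error term because (U/u)^(J+1) and ln(e u) are both at least 1; this
    is where ln(e u) rather than ln u matters, as ln u vanishes at u = 1.\<close>
  have "continuous_on {1..U} (expansion l (int \<kappa>) (\<kappa> + J))"
    by (rule DERIV_continuous_on[where D = "expansion l (int \<kappa> - 1) (\<kappa> + J)"])
       (auto intro!: has_field_derivative_at_within expansion_deriv)
  then have "bounded (expansion l (int \<kappa>) (\<kappa> + J) ` {1..U})"
    by (intro compact_imp_bounded compact_continuous_image) auto
  then obtain B where "\<forall>x\<in>expansion l (int \<kappa>) (\<kappa> + J) ` {1..U}. norm x \<le> B"
    unfolding bounded_iff by blast
  then have B: "\<bar>expansion l (int \<kappa>) (\<kappa> + J) u\<bar> \<le> B" if "u \<in> {1..U}" for u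
    using that by simp
  define B' where "B' = U ^ (\<kappa> + l) + fact \<kappa> * \<bar>B\<bar>"
  have "B' \<ge> 0" by (auto simp: B'_def U_def)
  have small: "\<bar>R u\<bar> \<le> B' * U ^ (J + 1) * ln (exp 1 * u) ^ l / u ^ (J + 1)" if "1 \<le> u" "u \<le> U" for u
  proof -
    have "\<bar>R u\<bar> \<le> \<bar>K_fun l u \<kappa>\<bar> + \<bar>fact \<kappa> * expansion l (int \<kappa>) (\<kappa> + J) u\<bar>"
      unfolding R_def by (rule abs_triangle_ineq4)
    also have "\<bar>K_fun l u \<kappa>\<bar> \<le> u ^ (\<kappa> + l)" using K_fun_bound[of u l \<kappa>] K_fun_nonneg[of l u \<kappa>] that by simp
    also have "u ^ (\<kappa> + l) \<le> U ^ (\<kappa> + l)" using that by (intro power_mono) auto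
    also have "\<bar>fact \<kappa> * expansion l (int \<kappa>) (\<kappa> + J) u\<bar> \<le> fact \<kappa> * \<bar>B\<bar>"
      using B[of u] that by (simp add: abs_mult)
    finally have "\<bar>R u\<bar> \<le> B' * 1" by (simp add: B'_def)
    also have "B' * 1 \<le> B' * (U ^ (J + 1) / u ^ (J + 1) * ln (exp 1 * u) ^ l)"
    proof (rule mult_left_mono[OF _ \<open>B' \<ge> 0\<close>])
      have "1 * 1 \<le> (U / u) ^ (J + 1) * ln (exp 1 * u) ^ l"
        using that by (intro mult_mono one_le_power) (auto simp: ln_e)
      then show "1 \<le> U ^ (J + 1) / u ^ (J + 1) * ln (exp 1 * u) ^ l" by (simp only: power_divide mult_1)
    qed
    finally show ?thesis by simp
  qed
  define M where "M = max c (B' * U ^ (J + 1))"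
  have "\<bar>R u\<bar> \<le> M * ln (exp 1 * u) ^ l / u ^ (J + 1)" if "u \<ge> real l" for u
  proof -
    have u: "u \<ge> 1" using that assms by linarith
    have le: "x * ln (exp 1 * u) ^ l / u ^ (J + 1) \<le> M * ln (exp 1 * u) ^ l / u ^ (J + 1)" if "x \<le> M" for x
      using that u by (intro divide_right_mono mult_right_mono) (auto simp: ln_e)
    show ?thesis
    proof (cases "u \<ge> U")
      case True
      from large[OF True] le[of c] show ?thesis by (simp add: M_def)
    next
      case False
      with small[OF u] le[of "B' * U ^ (J + 1)"] show ?thesis by (simp add: M_def)
    qed
  qed
  moreover have "R u = K_fun l u \<kappa>
      - (\<Sum>m=0..l. \<Sum>n=m..\<kappa>. \<Sum>r=0..l-m.
           (-1)^r * fact \<kappa> * E_coef n m / (fact m * fact (l-m-r))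
           * C_coef r (\<kappa>-n) * u ^ (\<kappa>-n) * ln u ^ (l-m-r))
      - (\<Sum>j=1..J. \<Sum>m=0..l. \<Sum>r=0..l-m.
           (-1)^r * fact \<kappa> * E_coef (\<kappa>+j) m / (fact m * fact (l-m-r))
           * C_coef r 0 * (deriv ^^ j) (\<lambda>x. ln x ^ (l-m-r)) u)" if "u \<ge> real l" for u
  proof -
    have "u > 0" using that assms by linarith
    then show ?thesis unfolding R_def by (subst main_terms_eq_expansion[symmetric]) (auto intro: diff_diff_eq[symmetric])
  qed
  ultimately show ?thesis by (intro exI[of _ M] allI impI) (simp only:)
qed

end
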